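(* The array of sets $Y(n;l)=D^b_l(n,l)$, for $n\in\mathbb N$ and $l\in\mathbb Z$ a vertex of $A_\infty^\infty$, is a Pascal $(A_\infty^\infty,0)$-array, with the following edge maps: (a) if $i>0$, the edge map for $i\to i+1$ is $\phi^1$ and the edge map for $i\to i-1$ is $\phi^u$; (b) if $i=0$, the edge map for $0\to 1$ is $\phi^1$ together with a blob on the new propagating line, and the edge map for $0\to-1$ is $\phi^1$ together with a square on the new propagating line; (c) if $i<0$, the edge map for $i\to i+1$ is $\phi^u$ and the edge map for $i\to i-1$ is $\phi^1$. This array underlies the sequence $(D^b(n,n))_{n\in\mathbb N}$, via the cutting of propagating lines.
   Context: $\mathbb N=\{0,1,2,\dots\}$. $A_\infty^\infty$ is the undirected graph with vertex set $\mathbb Z$ and an edge between $i$ and $i+1$ for each $i\in\mathbb Z$ (an undirected edge is regarded as two opposite directed edges). For a rooted graph $(G,v_0)$ with vertices $V$, directed edges $E$, and initial/final maps $i,f:E\to V$, a Pascal $(G,v_0)$-array is a family of sets $Y(n;v)$, $n\in\mathbb N$, $v\in V$, with $Y(0;v_0)$ a singleton and $Y(0;v)=\emptyset$ for $v\neq v_0$, together with injective edge maps $\phi'_e:Y(n-1;i(e))\hookrightarrow Y(n;f(e))$ ($e\in E$, $n\ge1$) such that $Y(n;v)=\bigsqcup_{e:\,f(e)=v}\phi'_e(Y(n-1;i(e)))$ (disjoint union). For undirected $G$, a Pascal $(G,v_0)$-array $Y$ underlies a sequence of sets $(\mathcal C(n))_n$ if there are bijections $\mathcal C(n)\cong\bigsqcup_{v}Y(n;v)\times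 Y'(n;v)$ for all $n$, with $Y'$ also a Pascal $(G,v_0)$-array. A Temperley–Lieb diagram in $D(n,m)$ is a non-crossing pair partition of $n+m$ points on the boundary of a rectangle, $n$ on the northern and $m$ on the southern edge, drawn by non-crossing arcs in the rectangle; an arc joining a northern to a southern point is a propagating line. An arc is exposed to the western end if it bounds the region of the complement of the arcs which contains the western edge of the rectangle. $D^b(n,m)$ is the set of diagrams in $D(n,m)$ in which each arc exposed to the western end is decorated with exactly one of: a blob, or a square; other arcs are undecorated. For $l\in\mathbb Z$, $D^b_l(n,l)$ denotes the set of half diagrams in $D^b(n,|l|)$ with exactly $|l|$ propagating lines (so all $|l|$ southern points lie on propagating lines), where the westernmost propagating line (the only exposed one) carries a blob if $l>0$ and a square if $l<0$. $\phi^1$ adds a new northern point and a new southern point at the far right joined by a new propagating line (undecorated unless stated otherwise), keeping existing decorations. $\phi^u$ (applied when there is at least one propagating line) moves the rightmost southern point to become a new rightmost northern point, i.e. bends over the rightmost propagating line, which keeps its decoration if any. Cutting: a diagram in $D^b(n,n)$ with $j$ propagating lines is cut from east to west through each propagating line once and through no other arc; the decoration of the westernmost propagating line (if $j>0$) is put on the corresponding line in both halves. The upper half is an element of $D^b_l(n,l)$ with $l=\pm j$ and the lower half is the upside-down reflection of an element of $D^b_l(n,l)$; $Y'$ is the array of these lower half diagrams. *)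

theory Defs
  imports Graph_Theory.Digraph "HOL-Library.Disjoint_Sets"
begin

section \<open>Pascal arrays\<close>

text \<open>
  The edge map of \<open>e\<close> from level \<open>n\<close> to level \<open>n + 1\<close> is \<open>\<phi> (Suc n) e\<close>. That it maps into
  \<open>Y (Suc n) (head G e)\<close> is part of the decomposition of \<open>Y (Suc n) v\<close>.
\<close>

definition pascal_array ::
  "('v, 'e) pre_digraph \<Rightarrow> 'v \<Rightarrow> (nat \<Rightarrow> 'v \<Rightarrow> 'a set) \<Rightarrow> (nat \<Rightarrow> 'e \<Rightarrow> 'a \<Rightarrow> 'a) \<Rightarrow> bool" where
  "pascal_array G v0 Y \<phi> \<longleftrightarrow>
     wf_digraph G \<and> v0 \<in> verts G \<and>
     (\<exists>y. Y 0 v0 = {y}) \<and>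
     (\<forall>v \<in> verts G. v \<noteq> v0 \<longrightarrow> Y 0 v = {}) \<and>
     (\<forall>n. \<forall>e \<in> arcs G. inj_on (\<phi> (Suc n) e) (Y n (tail G e))) \<and>
     (\<forall>n. \<forall>v \<in> verts G.
        Y (Suc n) v = (\<Union>e \<in> {e \<in> arcs G. head G e = v}. \<phi> (Suc n) e ` Y n (tail G e)) \<and>
        disjoint_family_on (\<lambda>e. \<phi> (Suc n) e ` Y n (tail G e)) {e \<in> arcs G. head G e = v})"

text \<open>
  \<open>Y\<close> underlies the sequence \<open>C\<close>, with the second array \<open>Y'\<close> and the bijections \<open>F n\<close> made
  explicit. The disjoint union over the vertices is a dependent sum.
\<close>

definition underlies ::
  "('v, 'e) pre_digraph \<Rightarrow> 'v \<Rightarrow> (nat \<Rightarrow> 'v \<Rightarrow> 'a set) \<Rightarrow> (nat \<Rightarrow> 'c set) \<Rightarrow>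
   (nat \<Rightarrow> 'v \<Rightarrow> 'b set) \<Rightarrow> (nat \<Rightarrow> 'c \<Rightarrow> 'v \<times> 'a \<times> 'b) \<Rightarrow> bool" where
  "underlies G v0 Y C Y' F \<longleftrightarrow>
     sym_digraph G \<and>
     (\<exists>\<phi>. pascal_array G v0 Y \<phi>) \<and>
     (\<exists>\<phi>'. pascal_array G v0 Y' \<phi>') \<and>
     (\<forall>n. bij_betw (F n) (C n) (SIGMA v:verts G. Y n v \<times> Y' n v))"

definition A_inf_inf :: "(int, int \<times> int) pre_digraph" where
  "A_inf_inf = \<lparr>verts = UNIV, arcs = {(i, j). j = i + 1 \<or> j = i - 1}, tail = fst, head = snd\<rparr>"


section \<open>Temperley--Lieb diagrams\<close>

text \<open>Points on each edge of the rectangle are numbered from \<open>0\<close>, from west to east.\<close>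

datatype point = North nat | South nat

definition points :: "nat \<Rightarrow> nat \<Rightarrow> point set" where
  "points n m = North ` {..<n} \<union> South ` {..<m}"

text \<open>Position on the boundary of the rectangle, clockwise from the north-western corner.\<close>

fun pos :: "nat \<Rightarrow> nat \<Rightarrow> point \<Rightarrow> nat" where
  "pos n m (North i) = i"
| "pos n m (South j) = n + (m - 1 - j)"

definition noncrossing :: "nat \<Rightarrow> nat \<Rightarrow> point set set \<Rightarrow> bool" where
  "noncrossing n m A \<longleftrightarrow>
     \<not> (\<exists>a b c d. {a, c} \<in> A \<and> {b, d} \<in> A \<and>
          pos n m a < pos n m b \<and> pos n m b < pos n m c \<and> pos n m c < pos n m d)"

definition TL :: "nat \<Rightarrow> nat \<Rightarrow> point set set set" where
  "TL n m = {A. partition_on (points n m) A \<and> (\<forall>e \<in> A. card e = 2) \<and> noncrossing n m A}"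

text \<open>
  The marked points cut the boundary of the rectangle into \<open>n + m\<close> intervals. Interval \<open>k\<close> is the
  one ending, clockwise, at the point in position \<open>k\<close>; so interval \<open>0\<close> contains the western edge.
  A region of the complement of the arcs is represented by the set of boundary intervals it meets:
  two intervals meet the same region iff no arc separates them. The intervals touching an end
  point in position \<open>k\<close> are \<open>k\<close> and \<open>k + 1\<close> (cyclically); they lie in the regions on the two
  sides of the arc ending there.
\<close>

definition separates :: "nat \<Rightarrow> nat \<Rightarrow> point set \<Rightarrow> nat \<Rightarrow> nat \<Rightarrow> bool" where
  "separates n m e k k' \<longleftrightarrow>
     (let I = {Min (pos n m ` e) <.. Max (pos n m ` e)} in (k \<in> I) \<noteq> (k' \<in> I))"

definition region :: "nat \<Rightarrow> nat \<Rightarrow> point set set \<Rightarrow> nat \<Rightarrow> nat set" where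
  "region n m A k = {k'. k' < n + m \<and> (\<forall>e \<in> A. \<not> separates n m e k k')}"

definition bounds :: "nat \<Rightarrow> nat \<Rightarrow> point set \<Rightarrow> nat set \<Rightarrow> bool" where
  "bounds n m e R \<longleftrightarrow> (\<exists>x \<in> e. pos n m x \<in> R \<or> (pos n m x + 1) mod (n + m) \<in> R)"

definition exposed :: "nat \<Rightarrow> nat \<Rightarrow> point set set \<Rightarrow> point set \<Rightarrow> bool" where
  "exposed n m A e \<longleftrightarrow> e \<in> A \<and> bounds n m e (region n m A 0)"

definition propagating :: "point set \<Rightarrow> bool" where
  "propagating e \<longleftrightarrow> (\<exists>i j. e = {North i, South j})"


section \<open>Decorated diagrams\<close>

datatype decoration = Blob | Square

text \<open>A strand is an arc together with its decoration, if it has one.\<close>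

record diagram =
  north :: nat
  south :: nat
  strands :: "(point set \<times> decoration option) set"

definition Db :: "nat \<Rightarrow> nat \<Rightarrow> diagram set" where
  "Db n m = {d. north d = n \<and> south d = m \<and>
     fst ` strands d \<in> TL n m \<and> inj_on fst (strands d) \<and>
     (\<forall>(e, c) \<in> strands d. c \<noteq> None \<longleftrightarrow> exposed n m (fst ` strands d) e)}"

definition prop_lines :: "diagram \<Rightarrow> point set set" where
  "prop_lines d = {e \<in> fst ` strands d. propagating e}"

text \<open>Propagating lines do not cross, so they can be compared at their northern end points.\<close>

definition west_of :: "point set \<Rightarrow> point set \<Rightarrow> bool" where
  "west_of e e' \<longleftrightarrow> (\<exists>i i'. North i \<in> e \<and> North i' \<in> e' \<and> i < i')"

definition westernmost :: "diagram \<Rightarrow> point set \<Rightarrow> bool" where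
  "westernmost d e \<longleftrightarrow> e \<in> prop_lines d \<and> (\<forall>e' \<in> prop_lines d. e' \<noteq> e \<longrightarrow> west_of e e')"

definition westernmost_carries :: "diagram \<Rightarrow> decoration \<Rightarrow> bool" where
  "westernmost_carries d c \<longleftrightarrow> (\<exists>e. westernmost d e \<and> (e, Some c) \<in> strands d)"

definition Db_half :: "nat \<Rightarrow> int \<Rightarrow> diagram set" where
  "Db_half n l = {d \<in> Db n (nat \<bar>l\<bar>). card (prop_lines d) = nat \<bar>l\<bar> \<and>
     (l > 0 \<longrightarrow> westernmost_carries d Blob) \<and> (l < 0 \<longrightarrow> westernmost_carries d Square)}"


section \<open>Edge maps\<close>

text \<open>\<open>phi_one c\<close> decorates the new line with \<open>c\<close>.\<close>

definition phi_one :: "decoration option \<Rightarrow> diagram \<Rightarrow> diagram" where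
  "phi_one c d = \<lparr>north = Suc (north d), south = Suc (south d),
     strands = insert ({North (north d), South (south d)}, c) (strands d)\<rparr>"

definition phi_u :: "diagram \<Rightarrow> diagram" where
  "phi_u d = \<lparr>north = Suc (north d), south = south d - 1,
     strands = map_prod (image (id(South (south d - 1) := North (north d)))) id ` strands d\<rparr>"

definition edge_map :: "int \<times> int \<Rightarrow> diagram \<Rightarrow> diagram" where
  "edge_map = (\<lambda>(i, j).
     if i > 0 then (if j = i + 1 then phi_one None else phi_u)
     else if i = 0 then (if j = 1 then phi_one (Some Blob) else phi_one (Some Square))
     else (if j = i + 1 then phi_u else phi_one None))"


section \<open>Cutting\<close>

fun flip_point :: "point \<Rightarrow> point" where
  "flip_point (North i) = South i"
| "flip_point (South i) = North i"

text \<open>Upside-down reflection.\<close>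

definition flip :: "diagram \<Rightarrow> diagram" where
  "flip d = \<lparr>north = south d, south = north d,
     strands = map_prod (image flip_point) id ` strands d\<rparr>"

definition Db_lower_half :: "nat \<Rightarrow> int \<Rightarrow> diagram set" where
  "Db_lower_half n l = flip ` Db_half n l"

text \<open>
  The cut meets the propagating lines in order from west to east, so the line \<open>e\<close> gives the new
  end point numbered \<open>cut_point d e\<close> in each half. Every piece keeps the decoration of its arc.
\<close>

definition cut_point :: "diagram \<Rightarrow> point set \<Rightarrow> nat" where
  "cut_point d e = card {e' \<in> prop_lines d. west_of e' e}"

definition upper_piece :: "diagram \<Rightarrow> point set \<Rightarrow> point set" where
  "upper_piece d e =
     (if propagating e then insert (South (cut_point d e)) (e \<inter> range North) else e)"

definition lower_piece :: "diagram \<Rightarrow> point set \<Rightarrow> point set" where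
  "lower_piece d e =
     (if propagating e then insert (North (cut_point d e)) (e \<inter> range South) else e)"

definition upper_half :: "diagram \<Rightarrow> diagram" where
  "upper_half d = \<lparr>north = north d, south = card (prop_lines d),
     strands = {(upper_piece d e, c) | e c. (e, c) \<in> strands d \<and> e \<inter> range North \<noteq> {}}\<rparr>"

definition lower_half :: "diagram \<Rightarrow> diagram" where
  "lower_half d = \<lparr>north = card (prop_lines d), south = south d,
     strands = {(lower_piece d e, c) | e c. (e, c) \<in> strands d \<and> e \<inter> range South \<noteq> {}}\<rparr>"

definition cut_index :: "diagram \<Rightarrow> int" where
  "cut_index d = (if westernmost_carries d Square then - int (card (prop_lines d))
                  else int (card (prop_lines d)))"

definition cut_diagram :: "diagram \<Rightarrow> int \<times> diagram \<times> diagram" where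
  "cut_diagram d = (cut_index d, upper_half d, lower_half d)"

end

theory Submission
  imports Defs
begin

text \<open>
  Number the points of the rectangle clockwise from the north-western corner. The resulting order
  does not depend on how many points there are, so it is a fixed linear order on \<open>point\<close>, and
  a diagram becomes a perfect matching of a finite subset of a linear order in which no arc
  separates the two ends of another one. An arc is exposed to the west exactly when no other arc
  straddles its ends (\<open>exposed_iff\<close>), so all of \<open>D\<^sup>b\<close> is described by betweenness alone
  (\<open>Db_iff\<close>) and is preserved by every relabelling of points that preserves or reverses the order.
  Two facts about decorations follow. Only the westernmost propagating line can be decorated
  (\<open>decorated_line_westernmost\<close>), and in a half diagram with at least one line it always is,
  because it ends at \<open>South 0\<close>, the last point of the order (\<open>line_to_south_0_decorated\<close>).

  \<^bold>\<open>The Pascal array.\<close> A half diagram at level \<open>n + 1\<close> is classified by the arc at its last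
  northern point \<open>North n\<close>. If this arc propagates, planarity makes it the easternmost line; its two
  ends are consecutive, so it can be deleted, and the diagram comes from exactly one half diagram
  with one line less under \<open>\<phi>\<^sup>1\<close>. Otherwise the arc can be bent back to the south. This only renames
  \<open>North n\<close> to a new easternmost southern point, which occupies the same place in the order; so
  the diagram comes from exactly one half diagram with one line more under \<open>\<phi>\<^sup>u\<close>. At the vertex \<open>0\<close>
  there are two candidates for the source, \<open>1\<close> and \<open>- 1\<close>. There the arc at \<open>North n\<close> is exposed, and
  its decoration tells which of the two it is (\<open>edge_map_image\<close>).

  \<^bold>\<open>Cutting.\<close> The upper half keeps the arcs that meet the northern edge, and renames the southern
  ends of the propagating lines by their rank (\<open>upper_half_Db\<close>). The lower half is
  the upper half of the reflected diagram, reflected back (\<open>lower_half_eq\<close>), which is legitimate because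
  planarity orders the lines in the same way at both ends. The inverse of the cut glues the
  \<open>k\<close>-th lines of the two halves to each other, for every \<open>k\<close>. The glued lines agree in decoration: only
  the lines at \<open>South 0\<close> are decorated, and the vertex \<open>l\<close> prescribes the same
  decoration for both (\<open>deco_line\<close>). So the glued strands form a diagram (\<open>glue_decorated\<close>), and
  cutting it returns the two halves (\<open>upper_half_glue\<close>). The array of lower halves is a
  Pascal array because it is the image of the array of upper halves under an injection.
\<close>

section \<open>Plane matchings of linearly ordered points\<close>

text \<open>
  The clockwise order from the north-western corner: southern points come after all northern ones
  and run from east to west, hence the reversed comparison.
\<close>

instantiation point :: linorder
begin

fun less_eq_point :: "point \<Rightarrow> point \<Rightarrow> bool" where
  "less_eq_point (North i) (North j) \<longleftrightarrow> i \<le> j"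
| "less_eq_point (North i) (South j) \<longleftrightarrow> True"
| "less_eq_point (South i) (North j) \<longleftrightarrow> False"
| "less_eq_point (South i) (South j) \<longleftrightarrow> j \<le> i"

definition less_point :: "point \<Rightarrow> point \<Rightarrow> bool" where
  "less_point x y \<longleftrightarrow> x \<le> y \<and> \<not> y \<le> x"

instance
proof
  fix x y z :: point
  show "x < y \<longleftrightarrow> x \<le> y \<and> \<not> y \<le> x" by (fact less_point_def)
  show "x \<le> x" by (cases x) auto
  show "x \<le> z" if "x \<le> y" "y \<le> z" using that by (cases x; cases y; cases z) auto
  show "x = y" if "x \<le> y" "y \<le> x" using that by (cases x; cases y) auto
  show "x \<le> y \<or> y \<le> x" by (cases x; cases y) auto
qed

end

lemma less_point_simps [simp]:
  "North i < North j \<longleftrightarrow> i < j"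
  "North i < South j"
  "\<not> South i < North j"
  "South i < South j \<longleftrightarrow> j < i"
  by (auto simp: less_point_def)

definition between :: "'p::linorder \<Rightarrow> 'p \<Rightarrow> 'p \<Rightarrow> bool" where
  "between a b x \<longleftrightarrow> a < x \<and> x < b \<or> b < x \<and> x < a"

text \<open>
  The point \<open>x\<close> is hidden from the outer region, the one that reaches beyond both ends of the order,
  by some arc. For points of the rectangle this outer region is the western one.
\<close>

definition covered :: "('p::linorder set \<times> 'c) set \<Rightarrow> 'p \<Rightarrow> bool" where
  "covered S x \<longleftrightarrow> (\<exists>a b c. ({a, b}, c) \<in> S \<and> between a b x)"

lemma covered_iff: "covered S x \<longleftrightarrow> (\<exists>a b c. ({a, b}, c) \<in> S \<and> a < b \<and> a < x \<and> x < b)"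
  unfolding covered_def between_def by (metis insert_commute order.strict_trans)

lemma between_commute: "between a b x \<longleftrightarrow> between b a x"
  by (auto simp: between_def)

text \<open>
  Betweenness expresses planarity without regard to the direction of the order: if one end of an arc
  lies between the ends of another arc, then so does its other end. For a perfect matching this is the
  same as the absence of crossings, and it passes to reflected diagrams unchanged.
\<close>

locale plane_matching =
  fixes P :: "'p::linorder set" and S :: "('p set \<times> 'c) set"
  assumes strand: "s \<in> S \<Longrightarrow> \<exists>x\<in>P. \<exists>y\<in>P. \<exists>c. s = ({x, y}, c) \<and> x \<noteq> y"
    and matched: "x \<in> P \<Longrightarrow> \<exists>y c. ({x, y}, c) \<in> S"
    and unique: "({x, y}, c) \<in> S \<Longrightarrow> ({x, y'}, c') \<in> S \<Longrightarrow> y = y' \<and> c = c'"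
    and planar: "({a, b}, c) \<in> S \<Longrightarrow> ({x, y}, c') \<in> S \<Longrightarrow> between a b x \<Longrightarrow> between a b y"
begin

lemma ends: "({x, y}, c) \<in> S \<Longrightarrow> x \<in> P \<and> y \<in> P \<and> x \<noteq> y"
  using strand[of "({x, y}, c)"] by (auto simp: doubleton_eq_iff)

lemma unique_left: "({x, y}, c) \<in> S \<Longrightarrow> ({x', y}, c') \<in> S \<Longrightarrow> x = x' \<and> c = c'"
  using unique[of y x c x' c'] by (simp add: insert_commute)

lemma reverse: "({x, y}, c) \<in> S \<Longrightarrow> ({y, x}, c) \<in> S"
  by (simp add: insert_commute)

lemma covered_ends: "({x, y}, c) \<in> S \<Longrightarrow> covered S x \<longleftrightarrow> covered S y"
  unfolding covered_def using planar reverse by meson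

end

text \<open>
  Both ends of an arc are covered or neither is, by \<open>covered_ends\<close>; so it suffices to speak of one
  end.
\<close>

locale decorated = plane_matching P S
  for P :: "'p::linorder set" and S :: "('p set \<times> decoration option) set" +
  assumes decor: "({x, y}, c) \<in> S \<Longrightarrow> c \<noteq> None \<longleftrightarrow> \<not> covered S x"

section \<open>Decorated diagrams as plane matchings\<close>

lemma mem_points [simp]:
  "North i \<in> points n m \<longleftrightarrow> i < n" "South i \<in> points n m \<longleftrightarrow> i < m"
  by (auto simp: points_def)

lemma pos_less_iff:
  "x \<in> points n m \<Longrightarrow> y \<in> points n m \<Longrightarrow> pos n m x < pos n m y \<longleftrightarrow> x < y"
  by (auto simp: points_def)

lemma pos_less: "x \<in> points n m \<Longrightarrow> pos n m x < n + m"
  by (auto simp: points_def)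

lemma mem_west_region:
  assumes "plane_matching (points n m) S"
  shows "k \<in> region n m (fst ` S) 0 \<longleftrightarrow> k < n + m \<and>
    (\<forall>a b c. ({a, b}, c) \<in> S \<longrightarrow> a < b \<longrightarrow> \<not> (pos n m a < k \<and> k \<le> pos n m b))"
proof -
  interpret plane_matching "points n m" S by fact
  have sep: "separates n m {a, b} 0 k \<longleftrightarrow> pos n m a < k \<and> k \<le> pos n m b"
    if "({a, b}, c) \<in> S" "a < b" for a b c
    using ends[OF that(1)] that(2) pos_less_iff[of a n m b]
    by (auto simp: separates_def)
  have "(\<forall>e\<in>fst ` S. \<not> separates n m e 0 k) \<longleftrightarrow>
      (\<forall>a b c. ({a, b}, c) \<in> S \<longrightarrow> a < b \<longrightarrow> \<not> separates n m {a, b} 0 k)"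
  proof safe
    fix e c assume *: "\<forall>a b c. ({a, b}, c) \<in> S \<longrightarrow> a < b \<longrightarrow> \<not> separates n m {a, b} 0 k"
      "(e, c) \<in> S" "separates n m (fst (e, c)) 0 k"
    obtain x y where "e = {x, y}" "x \<noteq> y" using strand[OF *(2)] by auto
    then have "e = {min x y, max x y}" "min x y < max x y" by (auto simp: min_def max_def)
    with * show False by (metis fst_conv)
  qed force
  then show ?thesis using sep by (auto simp: region_def)
qed

text \<open>
  Of the four intervals that touch the arc from \<open>x\<close> to \<open>y\<close>, the arc itself separates the two on its
  inner side from the west. The outer interval at either end lies in the western region iff no other arc
  covers that end.
\<close>

lemma exposed_iff:
  assumes "plane_matching (points n m) S" "({x, y}, c) \<in> S"
  shows "exposed n m (fst ` S) {x, y} \<longleftrightarrow> \<not> covered S x"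
proof -
  interpret plane_matching "points n m" S by fact
  have main: "bounds n m {x, y} (region n m (fst ` S) 0) \<longleftrightarrow> \<not> covered S x"
    if xy: "({x, y}, c) \<in> S" "x < y" for x y
  proof -
    let ?p = "pos n m" and ?R = "region n m (fst ` S) 0"
    note R = mem_west_region[OF assms(1)]
    have P: "x \<in> points n m" "y \<in> points n m" using ends[OF xy(1)] by auto
    have lt: "?p x < ?p y" "?p y < n + m" using P xy(2) by (auto simp: pos_less_iff pos_less)
    have arc: "a \<in> points n m" "b \<in> points n m" "a \<noteq> y" "b \<noteq> x"
      if "({a, b}, c') \<in> S" "a < b" for a b c'
      using ends[OF that(1)] unique[of y b c' x c] unique[of x a c' y c] that xy
      by (auto simp: insert_commute)
    have 1: "?p x \<in> ?R \<longleftrightarrow> \<not> covered S x"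
    proof -
      have *: "?p a < ?p x \<and> ?p x \<le> ?p b \<longleftrightarrow> a < x \<and> x < b"
        if "({a, b}, c') \<in> S" "a < b" for a b c'
        using arc[OF that] P pos_less_iff[of a n m x] pos_less_iff[of x n m b] pos_less_iff[of b n m x]
        by (auto simp: not_less[symmetric])
      have "?p x \<in> ?R \<longleftrightarrow>
          (\<forall>a b c. ({a, b}, c) \<in> S \<longrightarrow> a < b \<longrightarrow> \<not> (?p a < ?p x \<and> ?p x \<le> ?p b))"
        using lt by (simp only: R) (meson order.strict_trans)
      also have "\<dots> \<longleftrightarrow> (\<forall>a b c. ({a, b}, c) \<in> S \<longrightarrow> a < b \<longrightarrow> \<not> (a < x \<and> x < b))"
        by (intro iff_allI imp_cong refl arg_cong[where f = Not] *)
      finally show ?thesis unfolding covered_iff by blast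
    qed
    \<comment> \<open>The arc itself separates the intervals on its inner side from the west.\<close>
    have no: "k \<notin> ?R" if "?p x < k" "k \<le> ?p y" for k
      using that xy unfolding R by blast
    have 2: "(?p x + 1) mod (n + m) \<notin> ?R"
      using lt no[of "?p x + 1"] by simp
    have 3: "?p y \<notin> ?R"
      using lt no by simp
    \<comment> \<open>The outer interval at the last point of all is interval 0, the western edge itself.\<close>
    have 4: "(?p y + 1) mod (n + m) \<in> ?R \<longleftrightarrow> \<not> covered S y"
    proof (cases "?p y + 1 = n + m")
      case True
      have "\<not> between a b y" if "({a, b}, c') \<in> S" for a b c'
        using True ends[OF that] P pos_less_iff[of y n m a] pos_less_iff[of y n m b]
          pos_less[of a n m] pos_less[of b n m] by (auto simp: between_def)
      then show ?thesis using True lt by (auto simp: R covered_def)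
    next
      case False
      have *: "?p a < ?p y + 1 \<and> ?p y + 1 \<le> ?p b \<longleftrightarrow> a < y \<and> y < b"
        if "({a, b}, c') \<in> S" "a < b" for a b c'
        using arc[OF that] P pos_less_iff[of a n m y] pos_less_iff[of y n m b] pos_less_iff[of y n m a]
        by (auto simp: not_less[symmetric] less_Suc_eq_le)
      have "(?p y + 1) mod (n + m) = ?p y + 1" "?p y + 1 < n + m" using False lt by auto
      then have "(?p y + 1) mod (n + m) \<in> ?R \<longleftrightarrow>
          (\<forall>a b c. ({a, b}, c) \<in> S \<longrightarrow> a < b \<longrightarrow> \<not> (?p a < ?p y + 1 \<and> ?p y + 1 \<le> ?p b))"
        by (simp only: R simp_thms)
      also have "\<dots> \<longleftrightarrow> (\<forall>a b c. ({a, b}, c) \<in> S \<longrightarrow> a < b \<longrightarrow> \<not> (a < y \<and> y < b))"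
        by (intro iff_allI imp_cong refl arg_cong[where f = Not] *)
      finally show ?thesis unfolding covered_iff by blast
    qed
    show ?thesis using 1 2 3 4 covered_ends[OF xy(1)] by (auto simp: bounds_def)
  qed
  have "bounds n m {x, y} (region n m (fst ` S) 0) \<longleftrightarrow> \<not> covered S x"
  proof (cases "x < y")
    case True
    then show ?thesis using main assms(2) by blast
  next
    case False
    then have "y < x" using ends[OF assms(2)] by (meson linorder_neqE)
    then show ?thesis
      using main[OF reverse[OF assms(2)]] covered_ends[OF assms(2)] by (simp add: insert_commute)
  qed
  then show ?thesis using assms(2) by (force simp: exposed_def)
qed

text \<open>
  A crossing has exactly one end of one arc between the ends of the other, and conversely: the end of
  an arc that does not lie between the ends of another one lies strictly beyond them, as distinct arcs
  share no point.
\<close>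

lemma TL_iff:
  assumes inj: "inj_on fst S"
  shows "fst ` S \<in> TL n m \<longleftrightarrow> plane_matching (points n m) S"
proof
  assume TL: "fst ` S \<in> TL n m"
  then have part: "\<Union> (fst ` S) = points n m" "disjoint (fst ` S)" and two: "\<And>e c. (e, c) \<in> S \<Longrightarrow> card e = 2"
    and nc: "noncrossing n m (fst ` S)"
    by (force simp: TL_def partition_on_def)+
  have strand: "\<exists>x\<in>points n m. \<exists>y\<in>points n m. \<exists>c. s = ({x, y}, c) \<and> x \<noteq> y" if s: "s \<in> S" for s
  proof -
    obtain e c where ec: "s = (e, c)" by force
    with two s obtain x y where "e = {x, y}" "x \<noteq> y" by (metis card_2_iff)
    with ec s part(1) show ?thesis by (metis UN_I fst_conv insertCI)
  qed
  have ends: "x \<in> points n m \<and> y \<in> points n m \<and> x \<noteq> y" if "({x, y}, c) \<in> S" for x y c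
    using strand[OF that] by (auto simp: doubleton_eq_iff)
  have unique: "y = y' \<and> c = c'" if "({x, y}, c) \<in> S" "({x, y'}, c') \<in> S" for x y y' c c'
  proof -
    have "{x, y} = {x, y'}"
      using disjointD[OF part(2), of "{x, y}" "{x, y'}"] that by force
    then have "y = y'" by (auto simp: doubleton_eq_iff)
    with inj_onD[OF inj _ that] show ?thesis by auto
  qed
  show "plane_matching (points n m) S"
  proof
    show "\<exists>y c. ({x, y}, c) \<in> S" if "x \<in> points n m" for x
    proof -
      from that part(1) obtain s where s: "s \<in> S" "x \<in> fst s" by blast
      from strand[OF s(1)] obtain p q c where "s = ({p, q}, c)" by blast
      moreover from this s have "x = p \<or> x = q" by auto
      ultimately show ?thesis using s(1) by (metis insert_commute)
    qed
    show "between a b y" if *: "({a, b}, c) \<in> S" "({x, y}, c') \<in> S" "between a b x" for a b c x y c'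
    proof -
      have "y \<noteq> a" "y \<noteq> b"
        using unique[of y x c' b c] unique[of y x c' a c] * by (auto simp: insert_commute between_def)
      moreover have no: "\<not> (p < q \<and> q < r \<and> r < s)" if "({p, r}, t) \<in> S" "({q, s}, t') \<in> S" for p q r s t t'
      proof
        assume "p < q \<and> q < r \<and> r < s"
        then have "pos n m p < pos n m q \<and> pos n m q < pos n m r \<and> pos n m r < pos n m s"
          using ends[OF that(1)] ends[OF that(2)] by (simp add: pos_less_iff)
        moreover have "{p, r} \<in> fst ` S" "{q, s} \<in> fst ` S" using that by force+
        ultimately show False using nc unfolding noncrossing_def by blast
      qed
      moreover have "({b, a}, c) \<in> S" "({y, x}, c') \<in> S" using *(1,2) by (simp_all add: insert_commute)
      ultimately have "\<not> (a < x \<and> x < b \<and> b < y)" "\<not> (y < a \<and> a < x \<and> x < b)"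
        "\<not> (b < x \<and> x < a \<and> a < y)" "\<not> (y < b \<and> b < x \<and> x < a)" "y \<noteq> a" "y \<noteq> b"
        using no *(1,2) by blast+
      then show ?thesis using *(3) unfolding between_def by (metis linorder_neqE)
    qed
  qed (use strand unique in blast)+
next
  assume "plane_matching (points n m) S"
  then interpret plane_matching "points n m" S .
  have cover: "\<Union> (fst ` S) = points n m"
  proof
    show "\<Union> (fst ` S) \<subseteq> points n m"
    proof clarify
      fix p e c assume "(e, c) \<in> S" "p \<in> fst (e, c)"
      then show "p \<in> points n m" using strand[of "(e, c)"] by auto
    qed
    show "points n m \<subseteq> \<Union> (fst ` S)"
    proof
      fix p assume "p \<in> points n m"
      then obtain q c where "({p, q}, c) \<in> S" using matched by blast
      then show "p \<in> \<Union> (fst ` S)" by force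
    qed
  qed
  have disj: "e = e'" if *: "(e, c) \<in> S" "(e', c') \<in> S" "p \<in> e" "p \<in> e'" for e e' c c' p
  proof -
    obtain x where x: "e = {p, x}" using strand[OF *(1)] *(3) by auto
    obtain y where y: "e' = {p, y}" using strand[OF *(2)] *(4) by auto
    show ?thesis using *(1,2) x y unique by blast
  qed
  have "disjoint (fst ` S)"
  proof (rule disjointI)
    fix e e' assume "e \<in> fst ` S" "e' \<in> fst ` S" "e \<noteq> e'"
    then show "e \<inter> e' = {}" using disj by fastforce
  qed
  moreover have "card e = 2" if "(e, c) \<in> S" for e c
    using strand[OF that] by auto
  moreover have "noncrossing n m (fst ` S)"
    unfolding noncrossing_def
  proof safe
    fix p q r s t t' u u'
    assume *: "{p, r} = fst (t, u)" "(t, u) \<in> S" "{q, s} = fst (t', u')" "(t', u') \<in> S"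
      "pos n m p < pos n m q" "pos n m q < pos n m r" "pos n m r < pos n m s"
    then have S: "({p, r}, u) \<in> S" "({q, s}, u') \<in> S" by auto
    then have "p < q" "q < r" "r < s" using ends[OF S(1)] ends[OF S(2)] *(5-) by (auto simp: pos_less_iff)
    then show False using planar[OF S] by (auto simp: between_def)
  qed
  ultimately show "fst ` S \<in> TL n m"
    using cover by (force simp: TL_def partition_on_def)
qed

lemma Db_iff:
  "d \<in> Db n m \<longleftrightarrow> north d = n \<and> south d = m \<and> decorated (points n m) (strands d)"
proof -
  define S where "S = strands d"
  have "fst ` S \<in> TL n m \<and> inj_on fst S \<and> (\<forall>(e, c) \<in> S. c \<noteq> None \<longleftrightarrow> exposed n m (fst ` S) e)
      \<longleftrightarrow> decorated (points n m) S" (is "?L \<longleftrightarrow> ?R")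
  proof
    assume L: ?L
    then have pm: "plane_matching (points n m) S" using TL_iff by blast
    then interpret plane_matching "points n m" S .
    show ?R
    proof
      fix x y c assume xy: "({x, y}, c) \<in> S"
      with L have "c \<noteq> None \<longleftrightarrow> exposed n m (fst ` S) {x, y}" by auto
      then show "c \<noteq> None \<longleftrightarrow> \<not> covered S x" using exposed_iff[OF pm xy] by simp
    qed
  next
    assume R: ?R
    then interpret decorated "points n m" S .
    have pm: "plane_matching (points n m) S" ..
    have inj: "inj_on fst S"
    proof (rule inj_onI)
      fix s t assume st: "s \<in> S" "t \<in> S" "fst s = fst t"
      from strand[OF st(1)] obtain x y c where "s = ({x, y}, c)" by blast
      with st show "s = t" using unique[of x y c y "snd t"] by (cases t) auto
    qed
    moreover have "c \<noteq> None \<longleftrightarrow> exposed n m (fst ` S) e" if *: "(e, c) \<in> S" for e c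
    proof -
      obtain x y where "e = {x, y}" using strand[OF *] by blast
      with * show ?thesis using exposed_iff[OF pm] decor by simp
    qed
    ultimately show ?L using TL_iff[OF inj] pm by blast
  qed
  then show ?thesis by (auto simp: Db_def S_def)
qed

section \<open>Operations on plane matchings\<close>

definition rename :: "('p \<Rightarrow> 'q) \<Rightarrow> ('p set \<times> 'c) set \<Rightarrow> ('q set \<times> 'c) set" where
  "rename f S = map_prod (image f) id ` S"

lemma rename_rename: "rename f (rename g S) = rename (f \<circ> g) S"
  by (force simp: rename_def image_comp)

text \<open>
  Perfect matchings of the same points cannot be properly contained in each other.
\<close>

lemma plane_matching_eqI:
  assumes "plane_matching P S" "plane_matching P T"
    and sub: "\<And>x y c. ({x, y}, c) \<in> S \<Longrightarrow> ({x, y}, c) \<in> T"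
  shows "S = T"
proof -
  interpret S: plane_matching P S by fact
  interpret T: plane_matching P T by fact
  show ?thesis
  proof
    show "S \<subseteq> T" using S.strand sub by blast
    show "T \<subseteq> S"
    proof
      fix t assume t: "t \<in> T"
      then obtain x y c where xy: "t = ({x, y}, c)" "x \<in> P" using T.strand by blast
      obtain y' c' where S: "({x, y'}, c') \<in> S" using S.matched[OF xy(2)] by blast
      with T.unique[OF sub[OF S], of y c] t xy show "t \<in> S" by simp
    qed
  qed
qed

context plane_matching
begin

lemma mem_rename_iff:
  "({a, b}, c) \<in> rename f S \<longleftrightarrow> (\<exists>x y. ({x, y}, c) \<in> S \<and> a = f x \<and> b = f y)"
proof
  assume "({a, b}, c) \<in> rename f S"
  then obtain e where e: "(e, c) \<in> S" "{a, b} = f ` e" by (auto simp: rename_def)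
  then obtain x y where "e = {x, y}" using strand by blast
  with e show "\<exists>x y. ({x, y}, c) \<in> S \<and> a = f x \<and> b = f y"
    by (auto simp: doubleton_eq_iff dest: reverse)
qed (force simp: rename_def)

lemma rename_cong:
  assumes "\<And>x. x \<in> P \<Longrightarrow> f x = g x"
  shows "rename f S = rename g S"
proof -
  have "map_prod (image f) id s = map_prod (image g) id s" if "s \<in> S" for s
    using strand[OF that] assms by auto
  then show ?thesis unfolding rename_def by (rule image_cong[OF refl])
qed

lemma rename_ident:
  assumes "\<And>x. x \<in> P \<Longrightarrow> f x = x"
  shows "rename f S = S"
  using rename_cong[OF assms, of "\<lambda>x. x"] by (auto simp: rename_def map_prod_def)

end

text \<open>
  Planarity and exposure are defined by betweenness, so every relabelling that respects betweenness
  transports them. Order isomorphisms serve for \<open>\<phi>\<^sup>u\<close> and for cutting, the order-reversing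
  \<open>flip_point\<close> for the reflection.
\<close>

lemma (in decorated) decorated_rename:
  assumes inj: "inj_on f P"
    and btw: "\<And>a b x. a \<in> P \<Longrightarrow> b \<in> P \<Longrightarrow> x \<in> P \<Longrightarrow> between (f a) (f b) (f x) \<longleftrightarrow> between a b x"
  shows "decorated (f ` P) (rename f S)"
proof -
  have inj: "f x = f y \<longleftrightarrow> x = y" if "x \<in> P" "y \<in> P" for x y
    using inj that by (auto dest: inj_onD)
  show ?thesis
  proof
    fix s assume "s \<in> rename f S"
    then obtain s' where s': "s' \<in> S" "s = map_prod (image f) id s'" by (auto simp: rename_def)
    from strand[OF s'(1)] obtain x y c where "x \<in> P" "y \<in> P" "s' = ({x, y}, c)" "x \<noteq> y" by blast
    with s' inj show "\<exists>x\<in>f ` P. \<exists>y\<in>f ` P. \<exists>c. s = ({x, y}, c) \<and> x \<noteq> y"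
      by (intro bexI[of _ "f x"] bexI[of _ "f y"] exI[of _ c]) auto
  next
    fix x assume "x \<in> f ` P"
    then show "\<exists>y c. ({x, y}, c) \<in> rename f S"
      using matched unfolding mem_rename_iff by blast
  next
    fix x y c y' c' assume "({x, y}, c) \<in> rename f S" "({x, y'}, c') \<in> rename f S"
    then obtain p q p' q' where "({p, q}, c) \<in> S" "({p', q'}, c') \<in> S"
      "x = f p" "y = f q" "x = f p'" "y' = f q'" unfolding mem_rename_iff by blast
    then show "y = y' \<and> c = c'" using inj ends unique by metis
  next
    fix a b c x y c'
    assume "({a, b}, c) \<in> rename f S" "({x, y}, c') \<in> rename f S" and *: "between a b x"
    then obtain a' b' x' y' where S: "({a', b'}, c) \<in> S" "({x', y'}, c') \<in> S"
      and eq: "a = f a'" "b = f b'" "x = f x'" "y = f y'" unfolding mem_rename_iff by blast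
    with * btw planar[OF S] ends[OF S(1)] ends[OF S(2)] show "between a b y" by simp
  next
    fix x y c assume "({x, y}, c) \<in> rename f S"
    then obtain x' y' where S: "({x', y'}, c) \<in> S" and eq: "x = f x'" "y = f y'"
      unfolding mem_rename_iff by blast
    have "covered (rename f S) (f x') \<longleftrightarrow> covered S x'"
    proof
      assume "covered (rename f S) (f x')"
      then obtain a b t where t: "({a, b}, t) \<in> S" "between (f a) (f b) (f x')"
        unfolding covered_def mem_rename_iff by blast
      then show "covered S x'" using btw ends[OF t(1)] ends[OF S] unfolding covered_def by blast
    next
      assume "covered S x'"
      then obtain a b t where t: "({a, b}, t) \<in> S" "between a b x'"
        unfolding covered_def by blast
      then have "between (f a) (f b) (f x')" using btw ends[OF t(1)] ends[OF S] by blast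
      with t show "covered (rename f S) (f x')" unfolding covered_def mem_rename_iff by blast
    qed
    with eq decor[OF S] show "c \<noteq> None \<longleftrightarrow> \<not> covered (rename f S) x" by simp
  qed
qed

lemma decorated_rename_mono:
  assumes "decorated P S" and less: "\<And>x y. x \<in> P \<Longrightarrow> y \<in> P \<Longrightarrow> f x < f y \<longleftrightarrow> x < y"
  shows "decorated (f ` P) (rename f S)"
proof (rule decorated.decorated_rename[OF assms(1)])
  show "inj_on f P"
  proof (rule inj_onI)
    fix x y assume "x \<in> P" "y \<in> P" "f x = f y"
    then show "x = y" using less[of x y] less[of y x] by (metis less_irrefl linorder_neqE)
  qed
qed (simp add: between_def less)

text \<open>
  Deleting arcs could expose others. This cannot happen if every arc that covers a remaining one
  remains too.
\<close>

lemma (in decorated) decorated_restrict: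
  assumes "T \<subseteq> S"
    and closed: "\<And>x y c a b c'. ({x, y}, c) \<in> T \<Longrightarrow> ({a, b}, c') \<in> S \<Longrightarrow> between a b x \<Longrightarrow> ({a, b}, c') \<in> T"
  shows "decorated (\<Union> (fst ` T)) T"
proof
  fix s assume s: "s \<in> T"
  then obtain x y c where "s = ({x, y}, c)" "x \<noteq> y" using strand assms(1) by blast
  moreover from this s have "x \<in> \<Union> (fst ` T)" "y \<in> \<Union> (fst ` T)" by force+
  ultimately show "\<exists>x\<in>\<Union> (fst ` T). \<exists>y\<in>\<Union> (fst ` T). \<exists>c. s = ({x, y}, c) \<and> x \<noteq> y" by blast
next
  fix x assume "x \<in> \<Union> (fst ` T)"
  then obtain s where s: "s \<in> T" "x \<in> fst s" by blast
  then obtain p q c where pq: "s = ({p, q}, c)" using strand assms(1) by blast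
  with s have "x = p \<or> x = q" by auto
  with s(1) pq show "\<exists>y c. ({x, y}, c) \<in> T" by (metis insert_commute)
next
  fix x y c assume T: "({x, y}, c) \<in> T"
  have "covered T x \<longleftrightarrow> covered S x" using closed[OF T] assms(1) unfolding covered_def by blast
  then show "c \<noteq> None \<longleftrightarrow> \<not> covered T x" using decor T assms(1) by blast
qed (use assms(1) unique planar in blast)+

text \<open>
  An arc between neighbours covers nothing, and other arcs cover both of its ends or
  neither. So it disturbs no other decoration, and its own is dictated by the arcs already there.
\<close>

lemma (in decorated) decorated_insert:
  assumes "x < y" "x \<notin> P" "y \<notin> P"
    and adjacent: "\<And>p. p \<in> P \<Longrightarrow> \<not> between x y p"
    and c: "c \<noteq> None \<longleftrightarrow> \<not> covered S x"
  shows "decorated (insert x (insert y P)) (insert ({x, y}, c) S)"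
proof -
  have side: "p < x \<and> p < y \<or> x < p \<and> y < p" if "p \<in> P" for p
    using adjacent[OF that] assms(1-3) that unfolding between_def by (metis linorder_cases order.strict_trans)
  have same: "between a b x \<longleftrightarrow> between a b y" if "a \<in> P" "b \<in> P" for a b
    using side[OF that(1)] side[OF that(2)] assms(1) unfolding between_def by force
  have new: "({a, b}, t) \<in> insert ({x, y}, c) S \<longleftrightarrow>
      ({a, b}, t) \<in> S \<or> a = x \<and> b = y \<and> t = c \<or> a = y \<and> b = x \<and> t = c" for a b t
    by (auto simp: doubleton_eq_iff)
  have nb: "\<not> between x y p" "\<not> between y x p" if "p \<in> insert x (insert y P)" for p
    using that adjacent unfolding between_def by auto
  have covered: "covered (insert ({x, y}, c) S) p \<longleftrightarrow> covered S p" if "p \<in> insert x (insert y P)" for p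
    using nb[OF that] unfolding covered_def new by blast
  have inP: "a \<in> P" "b \<in> P" if "({a, b}, t) \<in> S" for a b t using ends[OF that] by auto
  show ?thesis
  proof
    fix s assume "s \<in> insert ({x, y}, c) S"
    then show "\<exists>p\<in>insert x (insert y P). \<exists>q\<in>insert x (insert y P). \<exists>c. s = ({p, q}, c) \<and> p \<noteq> q"
    proof
      assume "s = ({x, y}, c)" with assms(1) show ?thesis by blast
    next
      assume "s \<in> S" from strand[OF this] show ?thesis by blast
    qed
  next
    fix p assume "p \<in> insert x (insert y P)"
    then show "\<exists>q t. ({p, q}, t) \<in> insert ({x, y}, c) S" unfolding new using matched by blast
  next
    fix p q t q' t' assume "({p, q}, t) \<in> insert ({x, y}, c) S" "({p, q'}, t') \<in> insert ({x, y}, c) S"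
    then show "q = q' \<and> t = t'" unfolding new using unique inP assms(1-3) by blast
  next
    fix a b t p q t'
    assume *: "({a, b}, t) \<in> insert ({x, y}, c) S" "({p, q}, t') \<in> insert ({x, y}, c) S" "between a b p"
    have "p \<in> insert x (insert y P)" using *(2) inP unfolding new by blast
    then have ab: "({a, b}, t) \<in> S" using *(1,3) nb unfolding new by blast
    then have "between a b x \<longleftrightarrow> between a b y" using same inP by blast
    then show "between a b q" using *(2,3) planar[OF ab] unfolding new by blast
  next
    fix p q t assume *: "({p, q}, t) \<in> insert ({x, y}, c) S"
    have "p \<in> insert x (insert y P)" using * inP unfolding new by blast
    moreover have "covered S x \<longleftrightarrow> covered S y" using same inP unfolding covered_def by blast
    ultimately show "t \<noteq> None \<longleftrightarrow> \<not> covered (insert ({x, y}, c) S) p"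
      using * decor c covered unfolding new by metis
  qed
qed

lemma (in decorated) decorated_remove:
  assumes "({x, y}, c) \<in> S" and adjacent: "\<And>p. p \<in> P \<Longrightarrow> \<not> between x y p"
  shows "decorated (P - {x, y}) (S - {({x, y}, c)})"
proof -
  have "\<Union> (fst ` (S - {({x, y}, c)})) = P - {x, y}" (is "?U = _")
  proof
    show "?U \<subseteq> P - {x, y}"
    proof
      fix p assume "p \<in> ?U"
      then obtain s where s: "s \<in> S" "s \<noteq> ({x, y}, c)" "p \<in> fst s" by blast
      obtain e t where "s = (e, t)" by (rule prod.exhaust)
      with s have *: "(e, t) \<in> S" "(e, t) \<noteq> ({x, y}, c)" "p \<in> fst (e, t)" by simp_all
      then obtain q where e: "e = {p, q}" and p: "p \<in> P" using strand[OF *(1)] by auto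
      have "p \<noteq> x \<and> p \<noteq> y"
        using unique[OF assms(1), of q t] unique[OF reverse[OF assms(1)], of q t] *(1,2) e by (auto simp: insert_commute)
      with p show "p \<in> P - {x, y}" by blast
    qed
    show "P - {x, y} \<subseteq> ?U"
    proof
      fix p assume p: "p \<in> P - {x, y}"
      then obtain q t where "({p, q}, t) \<in> S" using matched by blast
      moreover from this p have "({p, q}, t) \<noteq> ({x, y}, c)" by (auto simp: doubleton_eq_iff)
      ultimately show "p \<in> ?U" by force
    qed
  qed
  moreover have "({a, b}, t') \<in> S - {({x, y}, c)}"
    if *: "({p, q}, t) \<in> S - {({x, y}, c)}" "({a, b}, t') \<in> S" "between a b p" for p q t a b t'
  proof -
    have "p \<in> P" using *(1) ends by blast
    then have "{a, b} \<noteq> {x, y}" using adjacent *(3) between_commute by (metis doubleton_eq_iff)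
    with * show ?thesis by blast
  qed
  ultimately show ?thesis using decorated_restrict[of "S - {({x, y}, c)}"] by auto
qed

section \<open>Propagating lines and half diagrams\<close>

lemma Db_decorated: "d \<in> Db n m \<Longrightarrow> decorated (points n m) (strands d)"
  by (simp add: Db_iff)

lemma prop_lines_eq: "prop_lines d = {{North i, South j} | i j c. ({North i, South j}, c) \<in> strands d}"
  by (force simp: prop_lines_def propagating_def)

lemma west_of_line [simp]: "west_of {North i, South j} {North i', South j'} \<longleftrightarrow> i < i'"
  by (auto simp: west_of_def)

text \<open>
  A line further west would cover both ends of this one, which would then not be exposed.
\<close>

lemma decorated_line_westernmost:
  assumes "decorated P S" "({North i, South j}, Some c) \<in> S" "({North i', South j'}, c') \<in> S"
  shows "i \<le> i' \<and> j \<le> j'"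
proof -
  interpret decorated P S by fact
  have "\<not> covered S (North i)" "\<not> covered S (South j)"
    using decor[OF assms(2)] covered_ends[OF assms(2)] by auto
  then have "\<not> between (North i') (South j') (North i)" "\<not> between (North i') (South j') (South j)"
    using assms(3) unfolding covered_def by blast+
  then show ?thesis by (auto simp: between_def)
qed

text \<open>
  As only the westernmost line can carry a decoration, the reference to the westernmost line may be dropped.
\<close>

lemma westernmost_carries_iff:
  assumes "d \<in> Db n m"
  shows "westernmost_carries d c \<longleftrightarrow> (\<exists>i j. ({North i, South j}, Some c) \<in> strands d)"
proof
  interpret decorated "points n m" "strands d" using Db_decorated[OF assms] .
  assume "\<exists>i j. ({North i, South j}, Some c) \<in> strands d"
  then obtain i j where ij: "({North i, South j}, Some c) \<in> strands d" by blast
  have "westernmost d {North i, South j}"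
    unfolding westernmost_def
  proof (intro conjI ballI impI)
    show "{North i, South j} \<in> prop_lines d" unfolding prop_lines_eq using ij by blast
    fix e' assume "e' \<in> prop_lines d" and ne: "e' \<noteq> {North i, South j}"
    then obtain i' j' c' where e': "e' = {North i', South j'}" "({North i', South j'}, c') \<in> strands d"
      unfolding prop_lines_eq by blast
    have "i \<le> i'"
      using decorated_line_westernmost[OF Db_decorated[OF assms] ij e'(2)] by simp
    moreover have "i \<noteq> i'" using unique ij e' ne by blast
    ultimately show "west_of {North i, South j} e'" using e' by simp
  qed
  with ij show "westernmost_carries d c" unfolding westernmost_carries_def by blast
qed (auto simp: westernmost_carries_def westernmost_def prop_lines_def propagating_def)

definition south_ends :: "(point set \<times> 'c) set \<Rightarrow> nat set" where
  "south_ends S = {j. \<exists>i c. ({North i, South j}, c) \<in> S}"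

lemma card_prop_lines:
  assumes "d \<in> Db n m"
  shows "card (prop_lines d) = card (south_ends (strands d))"
proof -
  interpret decorated "points n m" "strands d" using Db_decorated[OF assms] .
  have "bij_betw (\<lambda>e. THE j. South j \<in> e) (prop_lines d) (south_ends (strands d))"
  proof (intro bij_betwI')
    fix e e' assume *: "e \<in> prop_lines d" "e' \<in> prop_lines d"
    then obtain i j c i' j' c' where e: "e = {North i, South j}" "({North i, South j}, c) \<in> strands d"
      "e' = {North i', South j'}" "({North i', South j'}, c') \<in> strands d"
      unfolding prop_lines_eq by blast
    show "((THE j. South j \<in> e) = (THE j. South j \<in> e')) = (e = e')"
      using e(1,3) unique_left[OF e(2), of "North i'" c'] e(4) by auto
  next
    fix e assume "e \<in> prop_lines d"
    then obtain i j c where e: "e = {North i, South j}" "({North i, South j}, c) \<in> strands d"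
      unfolding prop_lines_eq by blast
    then have "(THE j. South j \<in> e) = j" by auto
    with e(2) show "(THE j. South j \<in> e) \<in> south_ends (strands d)"
      unfolding south_ends_def by blast
  next
    fix j assume "j \<in> south_ends (strands d)"
    then obtain i c where "({North i, South j}, c) \<in> strands d" unfolding south_ends_def by blast
    then show "\<exists>e\<in>prop_lines d. j = (THE j. South j \<in> e)"
      unfolding prop_lines_eq by (intro bexI[of _ "{North i, South j}"]) auto
  qed
  then show ?thesis by (rule bij_betw_same_card)
qed

lemma south_ends_subset:
  assumes "plane_matching (points n m) S"
  shows "south_ends S \<subseteq> {..<m}"
proof
  fix j assume "j \<in> south_ends S"
  then obtain i c where "({North i, South j}, c) \<in> S" unfolding south_ends_def by blast
  from plane_matching.ends[OF assms this] show "j \<in> {..<m}" by simp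
qed

text \<open>
  Counting lines is counting their southern ends, so there are \<open>m\<close> lines iff no southern point is left
  for an arc between southern points.
\<close>

lemma all_south_on_lines_iff:
  assumes "plane_matching (points n m) S"
  shows "card (south_ends S) = m \<longleftrightarrow> (\<forall>i j c. ({South i, South j}, c) \<notin> S)"
proof -
  interpret plane_matching "points n m" S by fact
  have "card (south_ends S) = m \<longleftrightarrow> south_ends S = {..<m}"
    using south_ends_subset[OF assms] by (metis card_lessThan card_subset_eq finite_lessThan)
  also have "\<dots> \<longleftrightarrow> (\<forall>i j c. ({South i, South j}, c) \<notin> S)"
  proof safe
    fix i j c assume eq: "south_ends S = {..<m}" and ij: "({South i, South j}, c) \<in> S"
    then have "i \<in> south_ends S" using ends[OF ij] by simp
    then obtain k t where "({North k, South i}, t) \<in> S" unfolding south_ends_def by blast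
    with unique[OF ij reverse[OF this]] show False by simp
  next
    fix j assume no: "\<forall>i j c. ({South i, South j}, c) \<notin> S" and "j < m"
    then obtain y c where y: "({South j, y}, c) \<in> S" using matched[of "South j"] by auto
    with no obtain i where "y = North i" by (cases y) auto
    with y reverse show "j \<in> south_ends S" unfolding south_ends_def by blast
  qed (use south_ends_subset[OF assms] in auto)
  finally show ?thesis .
qed

lemma south_line:
  assumes "plane_matching (points n m) S" "\<And>i j c. ({South i, South j}, c) \<notin> S" "j < m"
  obtains i c where "({North i, South j}, c) \<in> S" "i < n"
proof -
  interpret plane_matching "points n m" S by fact
  obtain y c where y: "({South j, y}, c) \<in> S" using matched[of "South j"] assms(3) by auto
  with assms(2) obtain i where i: "y = North i" by (cases y) auto
  with ends[OF y] reverse[OF y] that show ?thesis by simp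
qed

text \<open>
  \<open>South 0\<close> is the last point of the order, so nothing covers it.
\<close>

lemma line_to_south_0_decorated:
  assumes "decorated (points n m) S" "({North i, South 0}, c) \<in> S"
  shows "c \<noteq> None"
proof -
  interpret decorated "points n m" S by fact
  have "\<not> between a b (South 0)" for a b
    by (cases a; cases b) (auto simp: between_def)
  then have "\<not> covered S (South 0)" unfolding covered_def by blast
  then show ?thesis using decor[OF reverse[OF assms(2)]] by simp
qed

text \<open>
  The decoration that the vertex \<open>l\<close> prescribes for the westernmost line. At \<open>l = 0\<close> there is no line;
  the value \<open>Square\<close> there is arbitrary.
\<close>

definition line_deco :: "int \<Rightarrow> decoration" where
  "line_deco l = (if l > 0 then Blob else Square)"

text \<open>
  The form of the definition that is used from here on: the line counts become the absence of arcs
  between southern points, and existence of the prescribed decoration becomes a condition on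
  decorated lines, because the line at \<open>South 0\<close> is always decorated.
\<close>

lemma Db_half_iff:
  "d \<in> Db_half n l \<longleftrightarrow> d \<in> Db n (nat \<bar>l\<bar>) \<and>
     (\<forall>i j c. ({South i, South j}, c) \<notin> strands d) \<and>
     (\<forall>i j c. ({North i, South j}, Some c) \<in> strands d \<longrightarrow> c = line_deco l)" (is "?L \<longleftrightarrow> ?R")
proof (cases "d \<in> Db n (nat \<bar>l\<bar>)")
  case True
  interpret decorated "points n (nat \<bar>l\<bar>)" "strands d" using Db_decorated[OF True] .
  have pm: "plane_matching (points n (nat \<bar>l\<bar>)) (strands d)" ..
  have west: "westernmost_carries d c \<longleftrightarrow>
      (\<forall>i j c'. ({North i, South j}, Some c') \<in> strands d \<longrightarrow> c' = c)"
    if *: "l \<noteq> 0" "\<forall>i j c. ({South i, South j}, c) \<notin> strands d" for c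
  proof -
    obtain i t where it: "({North i, South 0}, t) \<in> strands d"
      by (rule south_line[OF pm, of 0]) (use * in auto)
    obtain c' where c': "({North i, South 0}, Some c') \<in> strands d"
      using line_to_south_0_decorated[OF Db_decorated[OF True] it] it by blast
    have "c1 = c2" if "({North i, South j}, Some c1) \<in> strands d" "({North i', South j'}, Some c2) \<in> strands d"
      for i j i' j' c1 c2
    proof -
      have "i = i'"
        using decorated_line_westernmost[OF Db_decorated[OF True] that]
          decorated_line_westernmost[OF Db_decorated[OF True] that(2,1)] by simp
      with unique[OF that(1)] that(2) show ?thesis by blast
    qed
    then show ?thesis unfolding westernmost_carries_iff[OF True] using c' by blast
  qed
  have "?L \<longleftrightarrow> (\<forall>i j c. ({South i, South j}, c) \<notin> strands d) \<and>
     (l > 0 \<longrightarrow> westernmost_carries d Blob) \<and> (l < 0 \<longrightarrow> westernmost_carries d Square)"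
    unfolding Db_half_def card_prop_lines[OF True] mem_Collect_eq
    using True all_south_on_lines_iff[OF pm] by (simp only: simp_thms)
  also have "\<dots> \<longleftrightarrow> ?R"
  proof (cases "l = 0")
    case l0: True
    then have "({North i, South j}, c) \<notin> strands d" for i j c
      using ends[of "North i" "South j" c] by auto
    then show ?thesis using True l0 by blast
  next
    case False
    show ?thesis
    proof (cases "\<forall>i j c. ({South i, South j}, c) \<notin> strands d")
      case no: True
      have "(l > 0 \<longrightarrow> westernmost_carries d Blob) \<and> (l < 0 \<longrightarrow> westernmost_carries d Square)
          \<longleftrightarrow> westernmost_carries d (line_deco l)"
        using False by (auto simp: line_deco_def)
      then show ?thesis unfolding west[OF False no] using no True by blast
    next
      case no: False
      then show ?thesis by meson
    qed
  qed
  finally show ?thesis .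
qed (auto simp: Db_half_def)

section \<open>The Pascal array of half diagrams\<close>

text \<open>
  The new points \<open>North n\<close> and \<open>South m\<close> are neighbours in the clockwise order, and the arcs passing over
  them are precisely the propagating lines. Hence the new line must be decorated iff it is the only
  one.
\<close>

lemma phi_one_Db:
  assumes "d \<in> Db n m" "c = None \<longleftrightarrow> (\<exists>i j t. ({North i, South j}, t) \<in> strands d)"
  shows "phi_one c d \<in> Db (Suc n) (Suc m)"
proof -
  interpret decorated "points n m" "strands d" using Db_decorated[OF assms(1)] .
  have "covered (strands d) (North n) \<longleftrightarrow> (\<exists>i j t. ({North i, South j}, t) \<in> strands d)"
  proof
    assume "covered (strands d) (North n)"
    then obtain a b t where t: "({a, b}, t) \<in> strands d" "a < North n" "North n < b" unfolding covered_iff by blast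
    obtain i where "a = North i" using t(2) by (cases a) auto
    moreover obtain j where "b = South j" using t(3) ends[OF t(1)] by (cases b) auto
    ultimately show "\<exists>i j t. ({North i, South j}, t) \<in> strands d" using t(1) by blast
  next
    assume "\<exists>i j t. ({North i, South j}, t) \<in> strands d"
    then obtain i j t where ij: "({North i, South j}, t) \<in> strands d" by blast
    with ends[OF ij] show "covered (strands d) (North n)" unfolding covered_iff
      by (intro exI[of _ "North i"] exI[of _ "South j"] exI[of _ t]) auto
  qed
  then have "decorated (insert (North n) (insert (South m) (points n m))) (insert ({North n, South m}, c) (strands d))"
    using assms(2) by (intro decorated_insert) (auto simp: points_def between_def)
  moreover have "insert (North n) (insert (South m) (points n m)) = points (Suc n) (Suc m)"
    by (auto simp: points_def)
  ultimately show ?thesis using assms(1) by (simp add: Db_iff phi_one_def)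
qed

text \<open>
  The decoration that the edge from \<open>i\<close> to \<open>j\<close>, leading away from \<open>0\<close>, puts on the new line.
\<close>

definition new_line_deco :: "int \<Rightarrow> int \<Rightarrow> decoration option" where
  "new_line_deco i j = (if i = 0 then Some (line_deco j) else None)"

lemma edge_map_outward:
  assumes "j = i + 1 \<or> j = i - 1" "\<bar>i\<bar> < \<bar>j\<bar>"
  shows "edge_map (i, j) = phi_one (new_line_deco i j)"
  using assms by (auto simp: edge_map_def new_line_deco_def line_deco_def)

lemma edge_map_inward:
  assumes "j = i + 1 \<or> j = i - 1" "\<bar>j\<bar> < \<bar>i\<bar>"
  shows "edge_map (i, j) = phi_u"
  using assms by (auto simp: edge_map_def)

lemma line_deco_adjacent:
  assumes "j = i + 1 \<or> j = i - 1" "i \<noteq> 0" "j \<noteq> 0"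
  shows "line_deco i = line_deco j"
  using assms by (auto simp: line_deco_def)

lemma phi_one_Db_half:
  assumes ij: "j = i + 1 \<or> j = i - 1" "\<bar>i\<bar> < \<bar>j\<bar>" and d: "d \<in> Db_half n i"
  shows "phi_one (new_line_deco i j) d \<in> Db_half (Suc n) j"
proof -
  let ?c = "new_line_deco i j" and ?m = "nat \<bar>i\<bar>"
  have m: "nat \<bar>j\<bar> = Suc ?m" using ij by auto
  have Db: "d \<in> Db n ?m" and SS: "\<And>i j c. ({South i, South j}, c) \<notin> strands d"
    and deco: "\<And>p q c. ({North p, South q}, Some c) \<in> strands d \<Longrightarrow> c = line_deco i"
    using d unfolding Db_half_iff by blast+
  interpret decorated "points n ?m" "strands d" using Db_decorated[OF Db] .
  have pm: "plane_matching (points n ?m) (strands d)" ..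
  have "?c = None \<longleftrightarrow> (\<exists>i j t. ({North i, South j}, t) \<in> strands d)"
  proof (cases "i = 0")
    case True
    then have "({North p, South q}, t) \<notin> strands d" for p q t
      using ends[of "North p" "South q" t] by auto
    then show ?thesis using True by (simp add: new_line_deco_def)
  next
    case False
    obtain p t where "({North p, South 0}, t) \<in> strands d"
      by (rule south_line[OF pm, of 0]) (use SS False in auto)
    then show ?thesis using False by (auto simp: new_line_deco_def)
  qed
  from phi_one_Db[OF Db this] have "phi_one ?c d \<in> Db (Suc n) (nat \<bar>j\<bar>)" using m by simp
  moreover have str: "strands (phi_one ?c d) = insert ({North n, South ?m}, ?c) (strands d)"
    using Db by (simp add: phi_one_def Db_iff)
  moreover have "c = line_deco j" if "({North p, South q}, Some c) \<in> strands (phi_one ?c d)" for p q c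
  proof (cases "({North p, South q}, Some c) \<in> strands d")
    case True
    then have "i \<noteq> 0" using ends[OF True] by auto
    then show ?thesis using deco[OF True] line_deco_adjacent[OF ij(1)] ij(2) by auto
  next
    case False
    then show ?thesis using that unfolding str
      by (auto simp: new_line_deco_def doubleton_eq_iff split: if_splits)
  qed
  ultimately show ?thesis unfolding Db_half_iff using SS by (auto simp: doubleton_eq_iff)
qed

text \<open>
  If the arc at \<open>North n\<close> is a line, it must end at the easternmost southern point, since the line ending
  there would otherwise cross it. Its decoration is forced as well: with \<open>i \<noteq> 0\<close> the line at \<open>South 0\<close> is a
  different one and covers it, with \<open>i = 0\<close> it is itself that line.
\<close>

lemma phi_one_Db_half_onto:
  assumes ij: "j = i + 1 \<or> j = i - 1" "\<bar>i\<bar> < \<bar>j\<bar>" and d: "d \<in> Db_half (Suc n) j"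
    and last: "({North n, South k}, c) \<in> strands d"
  shows "\<exists>d' \<in> Db_half n i. d = phi_one (new_line_deco i j) d'"
proof -
  let ?m = "nat \<bar>i\<bar>"
  have m: "nat \<bar>j\<bar> = Suc ?m" using ij by auto
  have Db: "d \<in> Db (Suc n) (Suc ?m)" and SS: "\<And>i j c. ({South i, South j}, c) \<notin> strands d"
    and deco: "\<And>p q c. ({North p, South q}, Some c) \<in> strands d \<Longrightarrow> c = line_deco j"
    using d unfolding Db_half_iff m by blast+
  interpret decorated "points (Suc n) (Suc ?m)" "strands d" using Db_decorated[OF Db] .
  have pm: "plane_matching (points (Suc n) (Suc ?m)) (strands d)" ..
  have k: "k = ?m"
  proof (rule ccontr)
    assume "k \<noteq> ?m"
    moreover obtain p t where p: "({North p, South ?m}, t) \<in> strands d" "p < Suc n"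
      by (rule south_line[OF pm, of ?m]) (use SS in auto)
    ultimately have "p \<noteq> n" using unique[OF last, of "South ?m" t] by auto
    with p(2) have "between (North p) (South ?m) (North n)" by (auto simp: between_def)
    from planar[OF p(1) last this] show False using ends[OF last] by (auto simp: between_def)
  qed
  have c: "c = new_line_deco i j"
  proof (cases "i = 0")
    case True
    then have "c \<noteq> None" using line_to_south_0_decorated[OF Db_decorated[OF Db]] last k by auto
    then show ?thesis using deco last True by (auto simp: new_line_deco_def)
  next
    case False
    obtain p t where p: "({North p, South 0}, t) \<in> strands d" "p < Suc n"
      by (rule south_line[OF pm, of 0]) (use SS in auto)
    have "p \<noteq> n" using unique[OF last, of "South 0" t] p False k by auto
    with p(2) have "between (North p) (South 0) (North n)" by (auto simp: between_def)
    then have "covered (strands d) (North n)" using p(1) unfolding covered_def by blast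
    then show ?thesis using decor[OF last] False by (simp add: new_line_deco_def)
  qed
  define d' where "d' = \<lparr>north = n, south = ?m, strands = strands d - {({North n, South ?m}, c)}\<rparr>"
  have "points (Suc n) (Suc ?m) - {North n, South ?m} = points n ?m"
    by (auto simp: points_def)
  moreover have "decorated (points (Suc n) (Suc ?m) - {North n, South ?m}) (strands d')"
    unfolding d'_def diagram.simps using last k
    by (intro decorated_remove) (auto simp: points_def between_def)
  ultimately have "d' \<in> Db n ?m" by (simp add: Db_iff d'_def)
  moreover have "t = line_deco i" if "({North p, South q}, Some t) \<in> strands d'" for p q t
  proof -
    have *: "({North p, South q}, Some t) \<in> strands d" "({North p, South q}, Some t) \<noteq> ({North n, South ?m}, c)"
      using that by (auto simp: d'_def)
    have "i \<noteq> 0"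
    proof
      assume "i = 0"
      then have "q = ?m" using ends[OF *(1)] by simp
      with unique_left[OF *(1), of "North n" c] last k *(2) show False by auto
    qed
    then show ?thesis using deco[OF *(1)] line_deco_adjacent[OF ij(1)] ij(2) by auto
  qed
  ultimately have "d' \<in> Db_half n i" unfolding Db_half_iff using SS by (auto simp: d'_def)
  moreover have "d = phi_one (new_line_deco i j) d'"
    using Db last unfolding k c[symmetric] by (cases d) (auto simp: phi_one_def d'_def Db_iff)
  ultimately show ?thesis by blast
qed

lemma phi_one_inj: "inj_on (phi_one c) (Db n m)"
proof (rule inj_onI)
  fix d e assume d: "d \<in> Db n m" and e: "e \<in> Db n m" and eq: "phi_one c d = phi_one c e"
  interpret d: decorated "points n m" "strands d" using Db_decorated[OF d] .
  interpret e: decorated "points n m" "strands e" using Db_decorated[OF e] .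
  have "({North n, South m}, c) \<notin> strands d" "({North n, South m}, c) \<notin> strands e"
    using d.ends[of "North n" "South m" c] e.ends[of "North n" "South m" c] by auto
  moreover have "insert ({North n, South m}, c) (strands d) = insert ({North n, South m}, c) (strands e)"
    using eq d e by (auto simp: phi_one_def Db_iff)
  ultimately have "strands d = strands e" by (simp add: insert_ident)
  then show "d = e" using d e by (cases d; cases e) (simp add: Db_iff)
qed

text \<open>
  \<open>\<phi>\<^sup>u\<close> acts on points by \<open>bend n m\<close>, the old southern edge having \<open>m + 1\<close> points. \<open>South m\<close> and \<open>North n\<close>
  have the same place in the order, just after the old northern points, so both maps preserve the
  order on the points concerned.
\<close>

definition bend :: "nat \<Rightarrow> nat \<Rightarrow> point \<Rightarrow> point" where
  "bend n m = id(South m := North n)"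

definition unbend :: "nat \<Rightarrow> nat \<Rightarrow> point \<Rightarrow> point" where
  "unbend n m = id(North n := South m)"

lemma unbend_bend: "x \<in> points n (Suc m) \<Longrightarrow> unbend n m (bend n m x) = x"
  by (cases x) (auto simp: bend_def unbend_def)

lemma bend_unbend: "x \<in> points (Suc n) m \<Longrightarrow> bend n m (unbend n m x) = x"
  by (cases x) (auto simp: bend_def unbend_def)

lemma bend_less: "x \<in> points n (Suc m) \<Longrightarrow> y \<in> points n (Suc m) \<Longrightarrow> bend n m x < bend n m y \<longleftrightarrow> x < y"
  by (auto simp: bend_def points_def)

lemma bend_points: "bend n m ` points n (Suc m) = points (Suc n) m"
proof
  show "bend n m ` points n (Suc m) \<subseteq> points (Suc n) m"
    by (auto simp: bend_def points_def)
  show "points (Suc n) m \<subseteq> bend n m ` points n (Suc m)"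
  proof
    fix x assume x: "x \<in> points (Suc n) m"
    have "unbend n m x \<in> points n (Suc m)" using x by (auto simp: unbend_def points_def)
    with bend_unbend[OF x] show "x \<in> bend n m ` points n (Suc m)" by (metis imageI)
  qed
qed

lemma unbend_points: "unbend n m ` points (Suc n) m = points n (Suc m)"
  unfolding bend_points[symmetric] image_image by (simp add: unbend_bend)

lemma unbend_less:
  assumes "x \<in> points (Suc n) m" "y \<in> points (Suc n) m"
  shows "unbend n m x < unbend n m y \<longleftrightarrow> x < y"
  using assms by (auto simp: unbend_def points_def)

lemma phi_u_eq_rename:
  "south d = Suc m \<Longrightarrow> north d = n \<Longrightarrow> phi_u d = \<lparr>north = Suc n, south = m, strands = rename (bend n m) (strands d)\<rparr>"
  by (simp add: phi_u_def rename_def bend_def)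

text \<open>
  Bending keeps decorations, so when the last line is bent its decoration survives on the arc at
  \<open>North n\<close>. The second statement records this; it is what separates the two edges into the vertex \<open>0\<close>.
\<close>

lemma phi_u_Db_half:
  assumes ij: "j = i + 1 \<or> j = i - 1" "\<bar>j\<bar> < \<bar>i\<bar>" and d: "d \<in> Db_half n i"
  shows "phi_u d \<in> Db_half (Suc n) j"
    "\<exists>k c. ({North k, North n}, c) \<in> strands (phi_u d) \<and> (j = 0 \<longrightarrow> c = Some (line_deco i))"
proof -
  let ?m = "nat \<bar>j\<bar>"
  have m: "nat \<bar>i\<bar> = Suc ?m" using ij by auto
  have Db: "d \<in> Db n (Suc ?m)" and SS: "\<And>i j c. ({South i, South j}, c) \<notin> strands d"
    and deco: "\<And>p q c. ({North p, South q}, Some c) \<in> strands d \<Longrightarrow> c = line_deco i"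
    using d unfolding Db_half_iff m by blast+
  interpret decorated "points n (Suc ?m)" "strands d" using Db_decorated[OF Db] .
  have pm: "plane_matching (points n (Suc ?m)) (strands d)" ..
  have u: "phi_u d = \<lparr>north = Suc n, south = ?m, strands = rename (bend n ?m) (strands d)\<rparr>"
    using Db by (intro phi_u_eq_rename) (auto simp: Db_iff)
  have dec: "decorated (points (Suc n) ?m) (rename (bend n ?m) (strands d))"
    using decorated_rename_mono[OF Db_decorated[OF Db], of "bend n ?m"] by (simp add: bend_points bend_less)
  interpret u: decorated "points (Suc n) ?m" "rename (bend n ?m) (strands d)" by fact
  have South: "x = South q" if "South q = bend n ?m x" for q x
    using that by (cases x) (auto simp: bend_def split: if_splits)
  have "({South p, South q}, c) \<notin> rename (bend n ?m) (strands d)" for p q c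
    unfolding mem_rename_iff using South SS by blast
  moreover have "c = line_deco j" if pq: "({North p, South q}, Some c) \<in> rename (bend n ?m) (strands d)" for p q c
  proof -
    have "q < ?m" using u.ends[OF pq] by simp
    then have "line_deco j = line_deco i" using line_deco_adjacent[OF ij(1)] ij(2) by auto
    moreover obtain x where x: "({x, South q}, Some c) \<in> strands d"
      using pq South unfolding mem_rename_iff by blast
    moreover from x SS obtain r where "x = North r" by (cases x) auto
    ultimately show ?thesis using deco by auto
  qed
  ultimately show "phi_u d \<in> Db_half (Suc n) j"
    unfolding Db_half_iff using dec by (auto simp: u Db_iff)
  obtain p c where p: "({North p, South ?m}, c) \<in> strands d"
    by (rule south_line[OF pm, of ?m]) (use SS in auto)
  have "({North p, North n}, c) \<in> strands (phi_u d)"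
    unfolding u diagram.simps mem_rename_iff using p
    by (intro exI[of _ "North p"] exI[of _ "South ?m"]) (auto simp: bend_def)
  moreover have "c = Some (line_deco i)" if "j = 0"
    using that p deco[of p 0] line_to_south_0_decorated[OF Db_decorated[OF Db], of p c] by (cases c) auto
  ultimately show "\<exists>k c. ({North k, North n}, c) \<in> strands (phi_u d) \<and> (j = 0 \<longrightarrow> c = Some (line_deco i))" by blast
qed

text \<open>
  Bending the arc at \<open>North n\<close> back makes it the easternmost line. It fits the vertex \<open>i\<close>: if \<open>j \<noteq> 0\<close>, the
  line at \<open>South 0\<close> covers \<open>North n\<close>, so the arc is undecorated; if \<open>j = 0\<close>, the last
  hypothesis gives the right decoration.
\<close>

lemma phi_u_Db_half_onto:
  assumes ij: "j = i + 1 \<or> j = i - 1" "\<bar>j\<bar> < \<bar>i\<bar>" and d: "d \<in> Db_half (Suc n) j"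
    and last: "({North k, North n}, c) \<in> strands d" and c: "j = 0 \<Longrightarrow> c = Some (line_deco i)"
  shows "\<exists>d' \<in> Db_half n i. d = phi_u d'"
proof -
  let ?m = "nat \<bar>j\<bar>"
  have m: "nat \<bar>i\<bar> = Suc ?m" using ij by auto
  have Db: "d \<in> Db (Suc n) ?m" and SS: "\<And>i j c. ({South i, South j}, c) \<notin> strands d"
    and deco: "\<And>p q c. ({North p, South q}, Some c) \<in> strands d \<Longrightarrow> c = line_deco j"
    using d unfolding Db_half_iff by blast+
  interpret decorated "points (Suc n) ?m" "strands d" using Db_decorated[OF Db] .
  have pm: "plane_matching (points (Suc n) ?m) (strands d)" ..
  have dec: "decorated (points n (Suc ?m)) (rename (unbend n ?m) (strands d))"
    using decorated_rename_mono[OF Db_decorated[OF Db], of "unbend n ?m"] by (simp add: unbend_points unbend_less)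
  define d' where "d' = \<lparr>north = n, south = Suc ?m, strands = rename (unbend n ?m) (strands d)\<rparr>"
  have South: "x = South q \<or> x = North n" if "South q = unbend n ?m x" for q x
    using that by (cases x) (auto simp: unbend_def split: if_splits)
  have N: "x = North q \<and> q \<noteq> n" if "North q = unbend n ?m x" for q x
    using that by (cases x) (auto simp: unbend_def split: if_splits)
  have "({South p, South q}, t) \<notin> rename (unbend n ?m) (strands d)" for p q t
  proof
    assume "({South p, South q}, t) \<in> rename (unbend n ?m) (strands d)"
    then obtain x y where xy: "({x, y}, t) \<in> strands d" "South p = unbend n ?m x" "South q = unbend n ?m y"
      unfolding mem_rename_iff by blast
    have "x = North n \<or> y = North n" "x \<noteq> y" using South[OF xy(2)] South[OF xy(3)] SS xy(1) ends[OF xy(1)] by auto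
    then show False using South[OF xy(2)] South[OF xy(3)] unique[OF xy(1)] unique_left[OF xy(1)] last reverse[OF last]
      by blast
  qed
  moreover have "t = line_deco i" if *: "({North p, South q}, Some t) \<in> rename (unbend n ?m) (strands d)" for p q t
  proof -
    obtain x where x: "({North p, x}, Some t) \<in> strands d" "South q = unbend n ?m x"
      using * N unfolding mem_rename_iff by blast
    from South[OF x(2)] show ?thesis
    proof
      assume "x = South q"
      then have "q < ?m" "t = line_deco j" using ends[OF x(1)] deco x(1) by auto
      then show ?thesis using line_deco_adjacent[OF ij(1)] ij(2) by auto
    next
      assume "x = North n"
      then have t: "c = Some t" using unique_left[OF x(1)] last by blast
      show ?thesis
      proof (cases "j = 0")
        case True
        then show ?thesis using c t by simp
      next
        case False
        obtain r s where r: "({North r, South 0}, s) \<in> strands d" "r < Suc n"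
          by (rule south_line[OF pm, of 0]) (use SS False in auto)
        have "r \<noteq> n" using unique[OF reverse[OF last], of "South 0" s] r(1) by auto
        with r(2) have "between (North r) (South 0) (North n)" by (auto simp: between_def)
        then have "covered (strands d) (North n)" using r(1) unfolding covered_def by blast
        then show ?thesis using decor[OF reverse[OF last]] t by simp
      qed
    qed
  qed
  ultimately have half: "d' \<in> Db_half n i"
    unfolding Db_half_iff m using dec by (auto simp: d'_def Db_iff)
  have "phi_u d' = \<lparr>north = Suc n, south = ?m, strands = rename (bend n ?m) (strands d')\<rparr>"
    by (intro phi_u_eq_rename) (auto simp: d'_def)
  moreover have "rename (bend n ?m) (strands d') = strands d"
    unfolding d'_def diagram.simps rename_rename by (rule rename_ident) (simp add: bend_unbend)
  ultimately have "phi_u d' = d"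
    using Db by (cases d) (simp add: Db_iff)
  with half show ?thesis by blast
qed

lemma phi_u_inj: "inj_on phi_u (Db n (Suc m))"
proof (rule inj_onI)
  fix d e assume d: "d \<in> Db n (Suc m)" and e: "e \<in> Db n (Suc m)" and eq: "phi_u d = phi_u e"
  have inv: "rename (unbend n m) (rename (bend n m) (strands d)) = strands d" if "d \<in> Db n (Suc m)" for d
  proof -
    interpret decorated "points n (Suc m)" "strands d" using Db_decorated[OF that] .
    show ?thesis unfolding rename_rename by (rule rename_ident) (simp add: unbend_bend)
  qed
  have "phi_u d = \<lparr>north = Suc n, south = m, strands = rename (bend n m) (strands d)\<rparr>"
    "phi_u e = \<lparr>north = Suc n, south = m, strands = rename (bend n m) (strands e)\<rparr>"
    using d e by (intro phi_u_eq_rename; simp add: Db_iff)+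
  then have "rename (bend n m) (strands d) = rename (bend n m) (strands e)" using eq by simp
  then have "strands d = strands e" using inv[OF d] inv[OF e] by metis
  then show "d = e" using d e by (cases d; cases e) (simp add: Db_iff)
qed

text \<open>
  The images of the edge maps, described by the arc at \<open>North n\<close> alone. Since every half diagram has
  exactly one such arc, the disjoint decomposition at each vertex can be read off.
\<close>

lemma edge_map_image:
  assumes ij: "j = i + 1 \<or> j = i - 1"
  shows "edge_map (i, j) ` Db_half n i = {d \<in> Db_half (Suc n) j.
    if \<bar>i\<bar> < \<bar>j\<bar> then \<exists>k c. ({North n, South k}, c) \<in> strands d
    else \<exists>k c. ({North k, North n}, c) \<in> strands d \<and> (j = 0 \<longrightarrow> c = Some (line_deco i))}"
proof (cases "\<bar>i\<bar> < \<bar>j\<bar>")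
  case True
  have "({North n, South (nat \<bar>i\<bar>)}, new_line_deco i j) \<in> strands (phi_one (new_line_deco i j) d)"
    if "d \<in> Db_half n i" for d
    using that by (simp add: Db_half_iff Db_iff phi_one_def)
  then show ?thesis
    using True phi_one_Db_half[OF ij True] phi_one_Db_half_onto[OF ij True]
    unfolding edge_map_outward[OF ij True] image_def by (simp only: if_True) blast
next
  case False
  then have less: "\<bar>j\<bar> < \<bar>i\<bar>" using ij by auto
  show ?thesis
    using False phi_u_Db_half[OF ij less] phi_u_Db_half_onto[OF ij less]
    unfolding edge_map_inward[OF ij less] image_def by (simp only: if_False) blast
qed

lemma edge_map_inj:
  assumes ij: "j = i + 1 \<or> j = i - 1"
  shows "inj_on (edge_map (i, j)) (Db_half n i)"
proof -
  have sub: "Db_half n i \<subseteq> Db n (nat \<bar>i\<bar>)" by (auto simp: Db_half_def)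
  show ?thesis
  proof (cases "\<bar>i\<bar> < \<bar>j\<bar>")
    case True
    show ?thesis unfolding edge_map_outward[OF ij True] by (rule inj_on_subset[OF phi_one_inj sub])
  next
    case False
    then have less: "\<bar>j\<bar> < \<bar>i\<bar>" using ij by auto
    have "nat \<bar>i\<bar> = Suc (nat \<bar>j\<bar>)" using ij less by auto
    then show ?thesis unfolding edge_map_inward[OF ij less] using inj_on_subset[OF phi_u_inj] sub by metis
  qed
qed

lemma Db_half_0: "Db_half 0 l = (if l = 0 then {\<lparr>north = 0, south = 0, strands = {}\<rparr>} else {})"
proof (cases "l = 0")
  case True
  have empty: "decorated {} S \<longleftrightarrow> S = {}" for S :: "(point set \<times> decoration option) set"
  proof
    assume "decorated {} S"
    then interpret decorated "{}" S .
    show "S = {}" using strand by blast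
  qed (unfold_locales; simp)
  have "points 0 0 = {}" by (simp add: points_def)
  then show ?thesis using True empty by (auto simp: Db_half_iff Db_iff)
next
  case False
  have "d \<notin> Db_half 0 l" for d
  proof
    assume "d \<in> Db_half 0 l"
    then have Db: "d \<in> Db 0 (nat \<bar>l\<bar>)" and SS: "\<And>i j c. ({South i, South j}, c) \<notin> strands d"
      unfolding Db_half_iff by blast+
    interpret decorated "points 0 (nat \<bar>l\<bar>)" "strands d" using Db_decorated[OF Db] .
    have pm: "plane_matching (points 0 (nat \<bar>l\<bar>)) (strands d)" ..
    show False by (rule south_line[OF pm, of 0]) (use SS False in auto)
  qed
  then show ?thesis using False by auto
qed

lemma A_inf_inf_simps [simp]:
  "verts A_inf_inf = UNIV" "tail A_inf_inf = fst" "head A_inf_inf = snd"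
  "(i, j) \<in> arcs A_inf_inf \<longleftrightarrow> j = i + 1 \<or> j = i - 1"
  by (auto simp: A_inf_inf_def)

lemma wf_A_inf_inf: "wf_digraph A_inf_inf"
  by unfold_locales simp_all

lemma sym_A_inf_inf: "sym_digraph A_inf_inf"
proof -
  interpret wf_digraph A_inf_inf by (rule wf_A_inf_inf)
  show ?thesis
  proof
    show "symmetric A_inf_inf"
      unfolding symmetric_conv
    proof
      fix e assume "e \<in> arcs A_inf_inf"
      then have rev: "(snd e, fst e) \<in> arcs A_inf_inf" by (cases e) auto
      show "\<exists>e'\<in>arcs A_inf_inf. tail A_inf_inf e = head A_inf_inf e' \<and> head A_inf_inf e = tail A_inf_inf e'"
        by (rule bexI[OF _ rev]) simp
    qed
  qed
qed

lemma arcs_into: "{e \<in> arcs A_inf_inf. head A_inf_inf e = v} = {(v - 1, v), (v + 1, v)}"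
  by auto

text \<open>
  At \<open>v \<noteq> 0\<close> one of the two edges into \<open>v\<close> leads away from \<open>0\<close> and the other towards it, so their images
  are told apart by whether the arc at \<open>North n\<close> propagates. At \<open>v = 0\<close> both edges lead towards \<open>0\<close>, and
  the decoration of that arc separates them.
\<close>

lemma pascal_array_Db_half: "pascal_array A_inf_inf 0 Db_half (\<lambda>n. edge_map)"
  unfolding pascal_array_def
proof (intro conjI allI ballI impI)
  fix n e assume "e \<in> arcs A_inf_inf"
  then show "inj_on (edge_map e) (Db_half n (tail A_inf_inf e))"
    using edge_map_inj by (cases e) auto
next
  fix n and v :: int
  note im = edge_map_image[of v "v - 1" n, simplified] edge_map_image[of v "v + 1" n, simplified]
  let ?N = "\<lambda>d. \<exists>k c. ({North k, North n}, c) \<in> strands d"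
  have last: "(\<exists>k c. ({North n, South k}, c) \<in> strands d) \<or> ?N d"
    "\<not> ((\<exists>k c. ({North n, South k}, c) \<in> strands d) \<and> ?N d)"
    "({North k, North n}, c) \<in> strands d \<Longrightarrow> ({North k', North n}, c') \<in> strands d \<Longrightarrow> c = c'"
    "v = 0 \<Longrightarrow> ({North k, North n}, c) \<in> strands d \<Longrightarrow> c = Some Blob \<or> c = Some Square"
    if "d \<in> Db_half (Suc n) v" for d k c k' c'
  proof -
    have Db: "d \<in> Db (Suc n) (nat \<bar>v\<bar>)" using that by (simp add: Db_half_iff)
    interpret decorated "points (Suc n) (nat \<bar>v\<bar>)" "strands d" using Db_decorated[OF Db] .
    obtain y t where y: "({North n, y}, t) \<in> strands d" using matched[of "North n"] by auto
    then show "(\<exists>k c. ({North n, South k}, c) \<in> strands d) \<or> ?N d"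
      using reverse[OF y] by (cases y) blast+
    show "\<not> ((\<exists>k c. ({North n, South k}, c) \<in> strands d) \<and> ?N d)"
      using unique reverse by (metis point.distinct(1))
    show "c = c'" if "({North k, North n}, c) \<in> strands d" "({North k', North n}, c') \<in> strands d"
      using unique_left[OF that] by simp
    show "c = Some Blob \<or> c = Some Square" if v: "v = 0" and kn: "({North k, North n}, c) \<in> strands d"
    proof -
      \<comment> \<open>Without southern points, North n is the last point of the order.\<close>
      have "\<not> between a b (North n)" if ab: "({a, b}, t) \<in> strands d" for a b t
        using ends[OF ab] v by (auto simp: points_def between_def)
      then have "c \<noteq> None" using decor[OF reverse[OF kn]] unfolding covered_def by blast
      then show ?thesis by (metis decoration.exhaust option.exhaust)
    qed
  qed
  have deco: "line_deco 1 = Blob" "line_deco (- 1) = Square" by (simp_all add: line_deco_def)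
  consider "v = 0" | "v > 0" | "v < 0" by linarith
  then have "Db_half (Suc n) v = edge_map (v - 1, v) ` Db_half n (v - 1) \<union> edge_map (v + 1, v) ` Db_half n (v + 1) \<and>
     edge_map (v - 1, v) ` Db_half n (v - 1) \<inter> edge_map (v + 1, v) ` Db_half n (v + 1) = {}"
  proof cases
    case 1
    have im': "edge_map (v - 1, v) ` Db_half n (v - 1) = {d \<in> Db_half (Suc n) v. \<exists>k. ({North k, North n}, Some Square) \<in> strands d}"
      "edge_map (v + 1, v) ` Db_half n (v + 1) = {d \<in> Db_half (Suc n) v. \<exists>k. ({North k, North n}, Some Blob) \<in> strands d}"
      unfolding im using 1 deco by auto
    have "?N d" if "d \<in> Db_half (Suc n) v" for d
    proof -
      have Db: "d \<in> Db (Suc n) 0" using that 1 by (simp add: Db_half_iff)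
      interpret decorated "points (Suc n) 0" "strands d" using Db_decorated[OF Db] .
      have "({North n, South k}, c) \<notin> strands d" for k c using ends[of "North n" "South k" c] by auto
      then show ?thesis using last(1)[OF that] by blast
    qed
    moreover have "\<exists>k. ({North k, North n}, Some Square) \<in> strands d \<or> ({North k, North n}, Some Blob) \<in> strands d"
      if "d \<in> Db_half (Suc n) v" "?N d" for d
      using last(4)[OF that(1) 1] that(2) by blast
    moreover have "\<not> (({North k, North n}, Some Square) \<in> strands d \<and> ({North k', North n}, Some Blob) \<in> strands d)"
      if "d \<in> Db_half (Suc n) v" for d k k'
      using last(3)[OF that, of k "Some Square" k' "Some Blob"] by blast
    ultimately show ?thesis unfolding im' by blast
  next
    case 2
    then have "\<bar>v - 1\<bar> < \<bar>v\<bar>" "\<not> \<bar>v + 1\<bar> < \<bar>v\<bar>" "v \<noteq> 0" by auto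
    then show ?thesis unfolding im using last(1,2) by auto
  next
    case 3
    then have "\<not> \<bar>v - 1\<bar> < \<bar>v\<bar>" "\<bar>v + 1\<bar> < \<bar>v\<bar>" "v \<noteq> 0" by auto
    then show ?thesis unfolding im using last(1,2) by auto
  qed
  then show "Db_half (Suc n) v = (\<Union>e \<in> {e \<in> arcs A_inf_inf. head A_inf_inf e = v}. edge_map e ` Db_half n (tail A_inf_inf e))"
    "disjoint_family_on (\<lambda>e. edge_map e ` Db_half n (tail A_inf_inf e)) {e \<in> arcs A_inf_inf. head A_inf_inf e = v}"
    unfolding arcs_into by (auto simp: disjoint_family_on_def)
qed (auto simp: Db_half_0 wf_A_inf_inf)

section \<open>Reflection and cutting\<close>

definition rank :: "nat set \<Rightarrow> nat \<Rightarrow> nat" where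
  "rank A k = card {x \<in> A. x < k}"

lemma rank_less:
  assumes "finite A" "k \<in> A" "k' \<in> A"
  shows "rank A k < rank A k' \<longleftrightarrow> k < k'"
proof -
  have mono: "rank A k < rank A k'" if "k \<in> A" "k < k'" for k k'
    unfolding rank_def using assms(1) that by (intro psubset_card_mono) auto
  show ?thesis using mono[OF assms(2)] mono[OF assms(3), of k] by (metis less_asym less_irrefl linorder_neqE)
qed

lemma rank_inj:
  assumes "finite A" "k \<in> A" "k' \<in> A" "rank A k = rank A k'"
  shows "k = k'"
  using rank_less[of A k k'] rank_less[of A k' k] assms by auto

lemma rank_image:
  assumes "finite A"
  shows "rank A ` A = {..<card A}"
proof (rule card_subset_eq)
  show "rank A ` A \<subseteq> {..<card A}"
    unfolding rank_def using assms by (auto intro!: psubset_card_mono)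
  have "inj_on (rank A) A" using rank_inj[OF assms] by (auto intro: inj_onI)
  then show "card (rank A ` A) = card {..<card A}" by (simp add: card_image)
qed simp

text \<open>
  An order isomorphism from \<open>A\<close> onto an initial segment is the rank function.
\<close>

lemma rank_unique:
  assumes mono: "\<And>a b. a \<in> A \<Longrightarrow> b \<in> A \<Longrightarrow> h a < h b \<longleftrightarrow> a < b"
    and image: "h ` A = {..<m}" and "a \<in> A"
  shows "rank A a = h a"
proof -
  have "inj_on h A"
    by (rule inj_onI) (metis mono less_irrefl linorder_neqE)
  then have "card (h ` {x \<in> A. x < a}) = card {x \<in> A. x < a}"
    by (intro card_image) (auto intro: inj_on_subset)
  moreover have "h ` {x \<in> A. x < a} = {..<h a}"
  proof
    show "h ` {x \<in> A. x < a} \<subseteq> {..<h a}" using mono assms(3) by auto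
    show "{..<h a} \<subseteq> h ` {x \<in> A. x < a}"
    proof
      fix k assume k: "k \<in> {..<h a}"
      moreover have "h a < m" using image assms(3) by auto
      ultimately have "k \<in> h ` A" unfolding image by simp
      then obtain b where "b \<in> A" "k = h b" by blast
      with k mono[OF this(1) assms(3)] show "k \<in> h ` {x \<in> A. x < a}" by auto
    qed
  qed
  ultimately show ?thesis by (simp add: rank_def)
qed

text \<open>
  Otherwise the two lines would cross. This is why the number of a line in the cut does not depend on
  the edge from which it is counted.
\<close>

lemma lines_same_order:
  assumes "plane_matching P S" "({North i, South j}, c) \<in> S" "({North i', South j'}, c') \<in> S"
  shows "i < i' \<longleftrightarrow> j < j'"
proof -
  interpret plane_matching P S by fact
  have *: "j < j'" if "({North i, South j}, c) \<in> S" "({North i', South j'}, c') \<in> S" "i < i'" for i j c i' j' c'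
    using planar[OF that(1,2)] that(3) by (auto simp: between_def)
  have "i = i' \<longleftrightarrow> j = j'"
    using unique[OF assms(2), of "South j'" c'] unique_left[OF assms(2), of "North i'" c'] assms(3) by auto
  then show ?thesis
    using *[OF assms(2,3)] *[OF assms(3,2)] by (metis less_asym less_irrefl linorder_neqE)
qed

lemma flip_point_flip_point [simp]: "flip_point (flip_point x) = x"
  by (cases x) auto

lemma flip_point_less [simp]: "flip_point x < flip_point y \<longleftrightarrow> y < x"
  by (cases x; cases y) auto

lemma between_flip_point [simp]: "between (flip_point a) (flip_point b) (flip_point x) \<longleftrightarrow> between a b x"
  by (auto simp: between_def)

lemma flip_eq: "flip d = \<lparr>north = south d, south = north d, strands = rename flip_point (strands d)\<rparr>"
  by (simp add: flip_def rename_def)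

lemma flip_flip [simp]: "flip (flip d) = d"
proof -
  have "flip_point \<circ> flip_point = (\<lambda>x. x)" by auto
  then show ?thesis
    by (cases d) (simp add: flip_eq rename_rename, simp add: rename_def map_prod_def)
qed

lemma inj_flip: "inj flip"
  by (metis flip_flip injI)

lemma flip_Db:
  assumes "d \<in> Db n m"
  shows "flip d \<in> Db m n"
proof -
  have "inj_on flip_point (points n m)" by (metis flip_point_flip_point inj_onI)
  then have "decorated (flip_point ` points n m) (rename flip_point (strands d))"
    by (rule decorated.decorated_rename[OF Db_decorated[OF assms]]) simp
  moreover have "flip_point ` points n m = points m n"
    by (force simp: points_def image_Un image_image)
  ultimately show ?thesis using assms by (simp add: Db_iff flip_eq)
qed

lemma image_flip_point_flip_point [simp]: "flip_point ` flip_point ` e = e"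
  by (simp add: image_image)

lemma mem_flip_iff: "(e, c) \<in> strands (flip d) \<longleftrightarrow> (flip_point ` e, c) \<in> strands d"
  by (auto simp: flip_eq rename_def) (force simp: image_iff map_prod_def)

lemma mem_flip_pair_iff [simp]:
  "({x, y}, c) \<in> strands (flip d) \<longleftrightarrow> ({flip_point x, flip_point y}, c) \<in> strands d"
  by (simp add: mem_flip_iff)

lemma prop_lines_flip: "prop_lines (flip d) = image flip_point ` prop_lines d"
proof -
  have sub: "image flip_point ` prop_lines d \<subseteq> prop_lines (flip d)" for d
    unfolding prop_lines_eq by (force simp: insert_commute)
  have "prop_lines (flip d) = image flip_point ` image flip_point ` prop_lines (flip d)"
    by (simp add: image_image)
  also have "\<dots> \<subseteq> image flip_point ` prop_lines d" using sub[of "flip d"] by (intro image_mono) simp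
  finally show ?thesis using sub by blast
qed

lemma card_prop_lines_flip: "card (prop_lines (flip d)) = card (prop_lines d)"
  unfolding prop_lines_flip by (intro card_image inj_onI) (metis image_flip_point_flip_point)

lemma cut_index_flip:
  assumes "d \<in> Db n m"
  shows "cut_index (flip d) = cut_index d"
proof -
  have "westernmost_carries (flip d) c \<longleftrightarrow> westernmost_carries d c" for c
    unfolding westernmost_carries_iff[OF assms] westernmost_carries_iff[OF flip_Db[OF assms]]
    by (auto simp: insert_commute)
  then show ?thesis by (simp add: cut_index_def card_prop_lines_flip)
qed

lemma cut_point_flip:
  assumes "d \<in> Db n m" "e \<in> prop_lines d"
  shows "cut_point (flip d) (flip_point ` e) = cut_point d e"
proof -
  interpret decorated "points n m" "strands d" using Db_decorated[OF assms(1)] .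
  have "west_of (flip_point ` e') (flip_point ` e) \<longleftrightarrow> west_of e' e" if *: "e' \<in> prop_lines d" for e'
  proof -
    obtain i j c where e: "e = {North i, South j}" "({North i, South j}, c) \<in> strands d"
      using assms(2) unfolding prop_lines_eq by blast
    obtain i' j' c' where e': "e' = {North i', South j'}" "({North i', South j'}, c') \<in> strands d"
      using * unfolding prop_lines_eq by blast
    show ?thesis
      using lines_same_order[OF plane_matching_axioms e'(2) e(2)] unfolding e(1) e'(1)
      by (simp add: insert_commute)
  qed
  then have "{e' \<in> prop_lines (flip d). west_of e' (flip_point ` e)} =
      image flip_point ` {e' \<in> prop_lines d. west_of e' e}"
    unfolding prop_lines_flip by auto
  then show ?thesis unfolding cut_point_def
    by (simp, intro card_image inj_onI) (metis image_flip_point_flip_point)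
qed

text \<open>
  Reduces every statement about lower halves to one about upper halves.
\<close>

lemma lower_half_eq:
  assumes "d \<in> Db n m"
  shows "lower_half d = flip (upper_half (flip d))"
proof -
  have piece: "flip_point ` upper_piece (flip d) e = lower_piece d (flip_point ` e)"
    if "(e, c) \<in> strands (flip d)" for e c
  proof (cases "propagating e")
    case True
    then have e: "e \<in> prop_lines (flip d)" using that by (force simp: prop_lines_def)
    have "flip_point ` e \<in> prop_lines d" using e unfolding prop_lines_flip by auto
    from cut_point_flip[OF assms this] have "cut_point (flip d) e = cut_point d (flip_point ` e)" by simp
    moreover obtain i j where "e = {North i, South j}" using True by (auto simp: propagating_def)
    ultimately show ?thesis
      by (auto simp: upper_piece_def lower_piece_def propagating_def insert_commute)
  next
    case False
    have "\<not> propagating (flip_point ` e)"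
    proof
      assume "propagating (flip_point ` e)"
      then obtain i j where "flip_point ` e = {North i, South j}" by (auto simp: propagating_def)
      then have "e = flip_point ` {North i, South j}" by (metis image_flip_point_flip_point)
      then have "e = {North j, South i}" by (simp add: insert_commute)
      with False show False unfolding propagating_def by blast
    qed
    with False show ?thesis by (simp add: upper_piece_def lower_piece_def)
  qed
  have meets: "flip_point ` e \<inter> range South \<noteq> {} \<longleftrightarrow> e \<inter> range North \<noteq> {}" for e
  proof -
    have "flip_point x \<in> range South \<longleftrightarrow> x \<in> range North" for x by (cases x) auto
    then show ?thesis by auto
  qed
  let ?T = "{s \<in> strands (flip d). fst s \<inter> range North \<noteq> {}}"
  let ?A = "{(lower_piece d e, c) | e c. (e, c) \<in> strands d \<and> e \<inter> range South \<noteq> {}}"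
  have "?A = (\<lambda>(e, c). (lower_piece d (flip_point ` e), c)) ` ?T" (is "_ = ?B")
  proof
    show "?A \<subseteq> ?B"
    proof clarify
      fix e c assume *: "(e, c) \<in> strands d" "e \<inter> range South \<noteq> {}"
      have "(flip_point ` e, c) \<in> ?T" using meets[of "flip_point ` e"] * by (simp add: mem_flip_iff)
      then show "(lower_piece d e, c) \<in> ?B" by (rule rev_image_eqI) simp
    qed
    show "?B \<subseteq> ?A"
    proof clarify
      fix e c assume "(e, c) \<in> strands (flip d)" "fst (e, c) \<inter> range North \<noteq> {}"
      then show "\<exists>e' c'. (lower_piece d (flip_point ` e), c) = (lower_piece d e', c') \<and>
          (e', c') \<in> strands d \<and> e' \<inter> range South \<noteq> {}"
        using meets[of e] by (intro exI[of _ "flip_point ` e"] exI[of _ c]) (simp add: mem_flip_iff)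
    qed
  qed
  also have "?B = (\<lambda>(e, c). (flip_point ` upper_piece (flip d) e, c)) ` ?T"
  proof (rule image_cong[OF refl])
    fix s assume "s \<in> ?T"
    then show "(\<lambda>(e, c). (lower_piece d (flip_point ` e), c)) s = (\<lambda>(e, c). (flip_point ` upper_piece (flip d) e, c)) s"
      using piece[of "fst s" "snd s"] by (simp add: case_prod_unfold)
  qed
  also have "\<dots> = rename flip_point ((\<lambda>(e, c). (upper_piece (flip d) e, c)) ` ?T)"
    by (simp add: rename_def image_comp comp_def case_prod_unfold map_prod_def)
  also have "(\<lambda>(e, c). (upper_piece (flip d) e, c)) ` ?T = strands (upper_half (flip d))"
    by (force simp: upper_half_def)
  finally have strands: "?A = rename flip_point (strands (upper_half (flip d)))" .
  have north: "north (upper_half (flip d)) = south d" by (simp add: upper_half_def flip_def)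
  have south: "south (upper_half (flip d)) = card (prop_lines d)"
    by (simp add: upper_half_def card_prop_lines_flip)
  show ?thesis
    unfolding lower_half_def strands flip_eq[of "upper_half (flip d)"] north south ..
qed

text \<open>
  The relabelling by which cutting moves southern ends: \<open>A\<close> is the set of southern ends of
  propagating lines.
\<close>

definition compress :: "nat set \<Rightarrow> point \<Rightarrow> point" where
  "compress A x = (case x of North i \<Rightarrow> North i | South j \<Rightarrow> South (rank A j))"

lemma compress_simps [simp]:
  "compress A (North i) = North i" "compress A (South j) = South (rank A j)"
  by (simp_all add: compress_def)

lemma cut_point_eq_rank:
  assumes "d \<in> Db n m" "({North i, South j}, c) \<in> strands d"
  shows "cut_point d {North i, South j} = rank (south_ends (strands d)) j"
proof -
  interpret decorated "points n m" "strands d" using Db_decorated[OF assms(1)] .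
  let ?L = "{e' \<in> prop_lines d. west_of e' {North i, South j}}"
  let ?R = "{j' \<in> south_ends (strands d). j' < j}"
  have "bij_betw (\<lambda>e. THE j. South j \<in> e) ?L ?R"
  proof (intro bij_betwI')
    fix e e' assume "e \<in> ?L" "e' \<in> ?L"
    then obtain i j c i' j' c' where e: "e = {North i, South j}" "({North i, South j}, c) \<in> strands d"
      "e' = {North i', South j'}" "({North i', South j'}, c') \<in> strands d"
      unfolding prop_lines_eq by blast
    show "((THE j. South j \<in> e) = (THE j. South j \<in> e')) = (e = e')"
      using e(1,3) unique_left[OF e(2), of "North i'" c'] e(4) by auto
  next
    fix e assume "e \<in> ?L"
    then obtain i' j' c' where e: "e = {North i', South j'}" "({North i', South j'}, c') \<in> strands d" "i' < i"
      unfolding prop_lines_eq by auto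
    then have "(THE j. South j \<in> e) = j'" by auto
    moreover have "j' < j" using lines_same_order[OF plane_matching_axioms e(2) assms(2)] e(3) by simp
    ultimately show "(THE j. South j \<in> e) \<in> ?R" using e(2) unfolding south_ends_def by auto
  next
    fix j' assume "j' \<in> ?R"
    then obtain i' c' where i': "({North i', South j'}, c') \<in> strands d" "j' < j" unfolding south_ends_def by blast
    then have "{North i', South j'} \<in> ?L"
      using lines_same_order[OF plane_matching_axioms i'(1) assms(2)] unfolding prop_lines_eq by auto
    then show "\<exists>e\<in>?L. j' = (THE j. South j \<in> e)"
      by (rule bexI[rotated]) auto
  qed
  then show ?thesis unfolding cut_point_def rank_def by (rule bij_betw_same_card)
qed

lemma upper_half_eq:
  assumes "d \<in> Db n m"
  shows "upper_half d = \<lparr>north = n, south = card (south_ends (strands d)),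
    strands = rename (compress (south_ends (strands d))) {s \<in> strands d. fst s \<inter> range North \<noteq> {}}\<rparr>"
proof -
  interpret decorated "points n m" "strands d" using Db_decorated[OF assms] .
  let ?g = "compress (south_ends (strands d))"
  have "upper_piece d e = ?g ` e" if ec: "(e, c) \<in> strands d" and meets: "e \<inter> range North \<noteq> {}" for e c
  proof -
    obtain i where i: "North i \<in> e" using meets by auto
    then obtain y where e: "e = {North i, y}" using strand[OF ec] by auto
    show ?thesis
    proof (cases y)
      case (North j)
      then show ?thesis by (auto simp: e upper_piece_def propagating_def doubleton_eq_iff)
    next
      case (South j)
      then have "propagating e" unfolding propagating_def e by blast
      moreover have "e \<inter> range North = {North i}" using South e by auto
      moreover have "cut_point d e = rank (south_ends (strands d)) j"
        using cut_point_eq_rank[OF assms, of i j c] ec by (simp add: e South)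
      ultimately have "upper_piece d e = {South (rank (south_ends (strands d)) j), North i}"
        unfolding upper_piece_def by simp
      then show ?thesis by (simp add: e South insert_commute)
    qed
  qed
  then have "{(upper_piece d e, c) | e c. (e, c) \<in> strands d \<and> e \<inter> range North \<noteq> {}} =
      {(?g ` e, c) | e c. (e, c) \<in> strands d \<and> e \<inter> range North \<noteq> {}}" by blast
  also have "\<dots> = rename ?g {s \<in> strands d. fst s \<inter> range North \<noteq> {}}"
    by (force simp: rename_def)
  finally show ?thesis using assms by (simp add: upper_half_def card_prop_lines[OF assms] Db_iff)
qed

text \<open>
  Cutting first discards the arcs between southern points, which by planarity cover no arc that meets
  the northern edge, and then closes the gaps left on the southern edge by an order isomorphism; so
  \<open>decorated_restrict\<close> and \<open>decorated_rename_mono\<close> apply. The three membership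
  statements determine the strands of the upper half completely.
\<close>

lemma upper_half_Db:
  assumes "d \<in> Db n m"
  shows "upper_half d \<in> Db n (card (south_ends (strands d)))"
    and "({North i, North j}, c) \<in> strands (upper_half d) \<longleftrightarrow> ({North i, North j}, c) \<in> strands d"
    and "({North i, South k}, c) \<in> strands (upper_half d) \<longleftrightarrow>
      (\<exists>j. ({North i, South j}, c) \<in> strands d \<and> k = rank (south_ends (strands d)) j)"
    and "({South k, South k'}, c) \<notin> strands (upper_half d)"
proof -
  interpret decorated "points n m" "strands d" using Db_decorated[OF assms] .
  let ?T = "{s \<in> strands d. fst s \<inter> range North \<noteq> {}}" and ?A = "south_ends (strands d)"
  have fin: "finite ?A" using south_ends_subset[OF plane_matching_axioms] finite_subset by blast
  have T: "decorated (\<Union> (fst ` ?T)) ?T"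
  proof (rule decorated_restrict)
    fix x y c a b c' assume *: "({x, y}, c) \<in> ?T" "({a, b}, c') \<in> strands d" "between a b x"
    have "between a b y" using planar[OF *(2) _ *(3)] *(1) by blast
    moreover have "x \<in> range North \<or> y \<in> range North" using *(1) by auto
    ultimately have "a \<in> range North \<or> b \<in> range North"
      using *(3) by (cases a; cases b) (auto simp: between_def)
    with *(2) show "({a, b}, c') \<in> ?T" by auto
  qed blast
  interpret T: decorated "\<Union> (fst ` ?T)" ?T by (fact T)
  have P: "\<Union> (fst ` ?T) = North ` {..<n} \<union> South ` ?A" (is "?U = ?V")
  proof
    show "?U \<subseteq> ?V"
    proof
      fix x assume "x \<in> ?U"
      then obtain y c where y: "({x, y}, c) \<in> ?T" using T.matched by blast
      then have xy: "({x, y}, c) \<in> strands d" by blast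
      show "x \<in> ?V"
      proof (cases x)
        case (North i)
        then show ?thesis using ends[OF xy] by simp
      next
        case (South j)
        then obtain i where "y = North i" using y by auto
        then have "j \<in> ?A" using reverse[OF xy] South unfolding south_ends_def by blast
        then show ?thesis using South by simp
      qed
    qed
    show "?V \<subseteq> ?U"
    proof
      fix x assume x: "x \<in> ?V"
      then consider i where "x = North i" "i < n" | j where "x = South j" "j \<in> ?A" by auto
      then obtain y c where "({x, y}, c) \<in> ?T"
      proof cases
        case 1
        then obtain y c where "({x, y}, c) \<in> strands d" using matched[of x] by auto
        with 1 show ?thesis by (intro that[of y c]) auto
      next
        case 2
        then obtain i c where "({North i, South j}, c) \<in> strands d" unfolding south_ends_def by blast
        from reverse[OF this] 2(1) show ?thesis by (intro that[of "North i" c]) auto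
      qed
      then show "x \<in> ?U" by force
    qed
  qed
  have less: "compress ?A x < compress ?A y \<longleftrightarrow> x < y" if "x \<in> ?U" "y \<in> ?U" for x y
    using that rank_less[OF fin] unfolding P by auto
  have image: "compress ?A ` ?U = points n (card ?A)"
    unfolding P points_def rank_image[OF fin, symmetric] image_Un image_image by simp
  have "decorated (points n (card ?A)) (rename (compress ?A) ?T)"
    using decorated_rename_mono[OF T less] image by simp
  then show "upper_half d \<in> Db n (card ?A)"
    unfolding upper_half_eq[OF assms] by (simp add: Db_iff)
  have g: "North i = compress ?A x \<longleftrightarrow> x = North i"
    "South k = compress ?A x \<longleftrightarrow> (\<exists>j. x = South j \<and> k = rank ?A j)" for x i k
    by (cases x; auto)+
  show "({North i, North j}, c) \<in> strands (upper_half d) \<longleftrightarrow> ({North i, North j}, c) \<in> strands d"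
    unfolding upper_half_eq[OF assms] diagram.simps T.mem_rename_iff g by auto
  show "({North i, South k}, c) \<in> strands (upper_half d) \<longleftrightarrow>
      (\<exists>j. ({North i, South j}, c) \<in> strands d \<and> k = rank ?A j)"
    unfolding upper_half_eq[OF assms] diagram.simps T.mem_rename_iff g by auto
  show "({South k, South k'}, c) \<notin> strands (upper_half d)"
    unfolding upper_half_eq[OF assms] diagram.simps T.mem_rename_iff g by auto
qed

text \<open>
  The sign of \<open>cut_index d\<close> is read off the one decorated line, which survives in the upper half with
  its decoration.
\<close>

lemma upper_half_in_Db_half:
  assumes "d \<in> Db n m"
  shows "upper_half d \<in> Db_half n (cut_index d)"
proof -
  interpret decorated "points n m" "strands d" using Db_decorated[OF assms] .
  have idx: "nat \<bar>cut_index d\<bar> = card (south_ends (strands d))"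
    by (simp add: cut_index_def card_prop_lines[OF assms])
  have "t = line_deco (cut_index d)" if u: "({North i, South k}, Some t) \<in> strands (upper_half d)" for i k t
  proof -
    obtain j where j: "({North i, South j}, Some t) \<in> strands d" using u upper_half_Db(3)[OF assms] by blast
    have uniq: "t = t'" if t': "({North i', South j'}, Some t') \<in> strands d" for i' j' t'
    proof -
      have "i = i'"
        using decorated_line_westernmost[OF Db_decorated[OF assms] j t']
          decorated_line_westernmost[OF Db_decorated[OF assms] t' j] by simp
      with unique[OF j] t' show ?thesis by blast
    qed
    have "j \<in> south_ends (strands d)" using j unfolding south_ends_def by blast
    moreover have "finite (south_ends (strands d))"
      using south_ends_subset[OF plane_matching_axioms] finite_subset by blast
    ultimately have pos: "card (prop_lines d) > 0"
      unfolding card_prop_lines[OF assms] by (auto simp: card_gt_0_iff)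
    have "westernmost_carries d Square \<longleftrightarrow> t = Square"
      unfolding westernmost_carries_iff[OF assms] using j uniq by blast
    then show ?thesis using pos by (cases t) (auto simp: cut_index_def line_deco_def)
  qed
  then show ?thesis
    unfolding Db_half_iff idx using upper_half_Db(1,4)[OF assms] by blast
qed

lemma cut_diagram_in_halves:
  assumes "d \<in> Db n m"
  shows "cut_diagram d \<in> (SIGMA v:UNIV. Db_half n v \<times> Db_lower_half m v)"
  using upper_half_in_Db_half[OF assms] upper_half_in_Db_half[OF flip_Db[OF assms]]
    cut_index_flip[OF assms] lower_half_eq[OF assms]
  unfolding cut_diagram_def Db_lower_half_def by auto

section \<open>Gluing two half diagrams\<close>

text \<open>
  Both halves are given upright, with their lines at the south; the second one is to be reflected
  before it is glued below the first. This makes the construction symmetric, exchanging the arguments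
  being the reflection of the result (\<open>rename_flip_glue\<close>), and halves the proofs below: each property need only be
  checked at northern points.
\<close>

definition glue :: "(point set \<times> 'c) set \<Rightarrow> (point set \<times> 'c) set \<Rightarrow> (point set \<times> 'c) set" where
  "glue U V =
     {({North i, North j}, c) | i j c. ({North i, North j}, c) \<in> U} \<union>
     {({South i, South j}, c) | i j c. ({North i, North j}, c) \<in> V} \<union>
     {({North i, South j}, c) | i j c. \<exists>k. ({North i, South k}, c) \<in> U \<and> ({North j, South k}, c) \<in> V}"

lemma mem_glue:
  "({North i, North j}, c) \<in> glue U V \<longleftrightarrow> ({North i, North j}, c) \<in> U"
  "({South i, South j}, c) \<in> glue U V \<longleftrightarrow> ({North i, North j}, c) \<in> V"
  "({North i, South j}, c) \<in> glue U V \<longleftrightarrow>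
    (\<exists>k. ({North i, South k}, c) \<in> U \<and> ({North j, South k}, c) \<in> V)"
  "({South j, North i}, c) \<in> glue U V \<longleftrightarrow>
    (\<exists>k. ({North i, South k}, c) \<in> U \<and> ({North j, South k}, c) \<in> V)"
  by (auto simp: glue_def doubleton_eq_iff insert_commute)

lemma mem_glue_swap: "({flip_point x, flip_point y}, c) \<in> glue V U \<longleftrightarrow> ({x, y}, c) \<in> glue U V"
  by (cases x; cases y) (auto simp: mem_glue)

lemma rename_flip_glue: "rename flip_point (glue U V) = glue V U"
proof -
  have sub: "rename flip_point (glue U V) \<subseteq> glue V U" for U V :: "(point set \<times> 'b) set"
  proof
    fix s assume "s \<in> rename flip_point (glue U V)"
    then obtain e c where e: "(e, c) \<in> glue U V" "s = (flip_point ` e, c)"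
      by (auto simp: rename_def)
    then obtain x y where "e = {x, y}" unfolding glue_def by blast
    with e show "s \<in> glue V U" by (simp add: mem_glue_swap)
  qed
  have "rename flip_point (rename flip_point (glue V U)) = glue V U"
    by (force simp: rename_rename rename_def image_iff)
  moreover have "rename flip_point (rename flip_point (glue V U)) \<subseteq> rename flip_point (glue U V)"
    using sub[of V U] unfolding rename_def[of flip_point "rename flip_point (glue V U)"]
      rename_def[of flip_point "glue U V"] by (rule image_mono)
  ultimately show ?thesis using sub by blast
qed

text \<open>
  The strands of an element of \<open>Db_half n l\<close> with \<open>m = \<bar>l\<bar>\<close>, with the prescribed decoration in place
  of the sign of \<open>l\<close>.
\<close>

locale half_diagram = decorated "points n m" S for n m and S :: "(point set \<times> decoration option) set" +
  fixes line_decoration :: decoration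
  assumes no_south_arc: "({South i, South j}, c) \<notin> S"
    and line_decoration: "({North i, South j}, Some t) \<in> S \<Longrightarrow> t = line_decoration"
begin

definition deco_of_line :: "nat \<Rightarrow> decoration option" where
  "deco_of_line k = (if k = 0 then Some line_decoration else None)"

lemma line_exists:
  assumes "k < m"
  obtains i c where "({North i, South k}, c) \<in> S" "i < n"
  by (rule south_line[OF plane_matching_axioms no_south_arc assms]) (use that in blast)

text \<open>
  The decoration of a line depends only on its number: the line at \<open>South 0\<close> is exposed and covers the
  southern ends of all others.
\<close>

lemma deco_line:
  assumes "({North i, South k}, c) \<in> S"
  shows "c = deco_of_line k"
proof (cases "k = 0")
  case True
  then have "c \<noteq> None" using line_to_south_0_decorated[OF decorated_axioms] assms by blast
  then show ?thesis using True line_decoration assms by (auto simp: deco_of_line_def)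
next
  case False
  have "k < m" using ends[OF assms] by simp
  with False have "0 < m" by simp
  then obtain p t where p: "({North p, South 0}, t) \<in> S" by (rule line_exists) blast
  with False have "between (North p) (South 0) (South k)" by (auto simp: between_def)
  then have "covered S (South k)" using p unfolding covered_def by blast
  then show ?thesis using decor[OF reverse[OF assms]] False by (simp add: deco_of_line_def)
qed

definition line_at :: "nat \<Rightarrow> nat" where
  "line_at i = (THE k. \<exists>c. ({North i, South k}, c) \<in> S)"

lemma line_at_eq:
  "({North i, South k}, c) \<in> S \<Longrightarrow> line_at i = k"
  unfolding line_at_def by (rule the_equality) (use unique in blast)+

lemma decorated_line_exists:
  assumes "k < m"
  obtains i where "({North i, South k}, deco_of_line k) \<in> S" "i < n"
  using line_exists[OF assms] deco_line by metis

end

text \<open>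
  The two halves may have different numbers of northern points, but they share the number of lines and
  the prescribed decoration.
\<close>

locale gluable = U: half_diagram n m U x + V: half_diagram n' m V x
  for n n' m U V x
begin

lemma gluable_swap: "gluable n' n m V U x" ..

lemma deco_eq: "U.deco_of_line k = V.deco_of_line k"
  by (simp add: U.deco_of_line_def V.deco_of_line_def)

text \<open>
  The \<open>k\<close>-th lines of the two halves have equal decorations, so every line of \<open>U\<close> continues to a line of the
  glued diagram.
\<close>

lemma extend_line:
  assumes "({North i, South k}, c) \<in> U"
  obtains j where "({North j, South k}, c) \<in> V" "({North i, South j}, c) \<in> glue U V" "j < n'"
proof -
  have "k < m" using U.ends[OF assms] by simp
  then obtain j where j: "({North j, South k}, V.deco_of_line k) \<in> V" "j < n'" using V.decorated_line_exists by blast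
  then have "({North j, South k}, c) \<in> V" using U.deco_line[OF assms] deco_eq by simp
  with that[OF this] j(2) assms show ?thesis unfolding mem_glue by blast
qed

lemma glue_matched_north:
  assumes "i < n"
  shows "\<exists>y c. ({North i, y}, c) \<in> glue U V"
proof -
  obtain y c where y: "({North i, y}, c) \<in> U" using U.matched[of "North i"] assms by auto
  show ?thesis
  proof (cases y)
    case (North j)
    with y show ?thesis by (intro exI[of _ y] exI[of _ c]) (simp add: mem_glue)
  next
    case (South k)
    with y extend_line show ?thesis by metis
  qed
qed

lemma glue_unique_north:
  assumes "({North i, y}, c) \<in> glue U V" "({North i, y'}, c') \<in> glue U V"
  shows "y = y' \<and> c = c'"
proof -
  \<comment> \<open>A glued strand at \<open>North i\<close> begins with a strand of \<open>U\<close>, which leaves only one continuation.\<close>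
  have U: "\<exists>z. ({North i, z}, c) \<in> U \<and>
      (case z of North j \<Rightarrow> y = North j | South k \<Rightarrow> \<exists>j. y = South j \<and> ({North j, South k}, c) \<in> V)"
    if "({North i, y}, c) \<in> glue U V" for y c
  proof (cases y)
    case (North j)
    with that show ?thesis by (intro exI[of _ "North j"]) (simp add: mem_glue)
  next
    case (South j)
    with that obtain k where "({North i, South k}, c) \<in> U" "({North j, South k}, c) \<in> V"
      by (auto simp: mem_glue)
    with South show ?thesis by (intro exI[of _ "South k"]) simp
  qed
  from U[OF assms(1)] obtain z where z: "({North i, z}, c) \<in> U"
    "case z of North j \<Rightarrow> y = North j | South k \<Rightarrow> \<exists>j. y = South j \<and> ({North j, South k}, c) \<in> V" by blast
  from U[OF assms(2)] obtain z' where z': "({North i, z'}, c') \<in> U"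
    "case z' of North j \<Rightarrow> y' = North j | South k \<Rightarrow> \<exists>j. y' = South j \<and> ({North j, South k}, c') \<in> V" by blast
  have eq: "z = z'" "c = c'" using U.unique[OF z(1) z'(1)] by auto
  have "y = y'"
  proof (cases z)
    case (North j)
    then show ?thesis using z(2) z'(2) eq by simp
  next
    case (South k)
    then obtain j j' where "y = South j" "({North j, South k}, c) \<in> V" "y' = South j'" "({North j', South k}, c') \<in> V"
      using z(2) z'(2) eq by auto
    with V.unique_left show ?thesis by blast
  qed
  with eq show ?thesis by simp
qed

text \<open>
  Planarity of \<open>U\<close> decides everything above the seam. For two lines it gives the order of their
  numbers, and planarity of \<open>V\<close> carries that order on to their southern ends.
\<close>

lemma glue_planar_north:
  assumes ab: "({a, b}, c) \<in> glue U V" and r: "({North r, y}, c') \<in> glue U V" and btw: "between a b (North r)"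
  shows "between a b y"
proof -
  have line: "between (North p) (South q) y"
    if pq: "({North p, South q}, c) \<in> glue U V" and "between (North p) (South q) (North r)" for p q
  proof -
    have pr: "p < r" using that(2) by (auto simp: between_def)
    from pq obtain k where k: "({North p, South k}, c) \<in> U" "({North q, South k}, c) \<in> V"
      unfolding mem_glue by blast
    have btw: "between (North p) (South k) (North r)" using pr by (auto simp: between_def)
    show ?thesis
    proof (cases y)
      case (North s)
      then have "({North r, North s}, c') \<in> U" using r by (simp add: mem_glue)
      from U.planar[OF k(1) this btw] North show ?thesis by (auto simp: between_def)
    next
      case (South j)
      then obtain k' where k': "({North r, South k'}, c') \<in> U" "({North j, South k'}, c') \<in> V"
        using r by (auto simp: mem_glue)
      have "k < k'" using lines_same_order[OF U.plane_matching_axioms k(1) k'(1)] pr by simp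
      then have "q < j" using lines_same_order[OF V.plane_matching_axioms k(2) k'(2)] by simp
      then show ?thesis using South by (auto simp: between_def)
    qed
  qed
  show ?thesis
  proof (cases a)
    case a: (North p)
    show ?thesis
    proof (cases b)
      case b: (North q)
      have ab': "({North p, North q}, c) \<in> U" using ab a b by (simp add: mem_glue)
      have btw': "between (North p) (North q) (North r)" using btw a b by simp
      show ?thesis
      proof (cases y)
        case (North s)
        then have "({North r, North s}, c') \<in> U" using r by (simp add: mem_glue)
        from U.planar[OF ab' this btw'] show ?thesis using a b North by simp
      next
        case (South j)
        then obtain k where "({North r, South k}, c') \<in> U" using r by (auto simp: mem_glue)
        from U.planar[OF ab' this btw'] show ?thesis by (auto simp: between_def)
      qed
    next
      case b: (South q)
      then show ?thesis using line ab btw a by simp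
    qed
  next
    case a: (South q)
    show ?thesis
    proof (cases b)
      case b: (North p)
      have "({North p, South q}, c) \<in> glue U V" using ab a b by (simp add: insert_commute)
      moreover have "between (North p) (South q) (North r)" using btw a b between_commute by blast
      ultimately show ?thesis using line a b between_commute by blast
    next
      case b: (South s)
      then show ?thesis using btw a by (auto simp: between_def)
    qed
  qed
qed

text \<open>
  A line covers \<open>North i\<close> iff it starts further west, wherever it ends in the south; so gluing does not
  change which northern points are covered.
\<close>

lemma glue_covered_north: "covered (glue U V) (North i) \<longleftrightarrow> covered U (North i)"
proof
  assume "covered (glue U V) (North i)"
  then obtain a b c where ab: "({a, b}, c) \<in> glue U V" "a < North i" "North i < b" unfolding covered_iff by blast
  obtain p where a: "a = North p" using ab(2) by (cases a) auto
  show "covered U (North i)"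
  proof (cases b)
    case (North q)
    then have "({a, b}, c) \<in> U" using ab(1) a by (simp add: mem_glue)
    with ab show ?thesis unfolding covered_def between_def by blast
  next
    case (South q)
    then obtain k where "({North p, South k}, c) \<in> U" using ab(1) a by (auto simp: mem_glue)
    then show ?thesis unfolding covered_iff using ab(2) a less_point_simps(2) by blast
  qed
next
  assume "covered U (North i)"
  then obtain a b c where ab: "({a, b}, c) \<in> U" "a < North i" "North i < b" unfolding covered_iff by blast
  obtain p where a: "a = North p" using ab(2) by (cases a) auto
  show "covered (glue U V) (North i)"
  proof (cases b)
    case (North q)
    then have "({a, b}, c) \<in> glue U V" using ab(1) a by (simp add: mem_glue)
    with ab show ?thesis unfolding covered_def between_def by blast
  next
    case (South k)
    then obtain j where "({North p, South j}, c) \<in> glue U V" using ab(1) a extend_line by metis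
    then show ?thesis unfolding covered_iff using ab(2) a less_point_simps(2) by blast
  qed
qed

lemma glue_decor_north:
  assumes "({North i, y}, c) \<in> glue U V"
  shows "c \<noteq> None \<longleftrightarrow> \<not> covered (glue U V) (North i)"
proof -
  obtain z where "({North i, z}, c) \<in> U"
    using assms by (cases y) (auto simp: mem_glue)
  from U.decor[OF this] show ?thesis by (simp add: glue_covered_north)
qed

lemma covered_glue_swap: "covered (glue V U) (flip_point p) \<longleftrightarrow> covered (glue U V) p"
proof -
  have "covered (glue V U) (flip_point p)" if "covered (glue U V) p" for U V :: "(point set \<times> decoration option) set" and p
    using that unfolding covered_def by (metis between_flip_point mem_glue_swap)
  from this[of V U "flip_point p"] this[of U V p] show ?thesis by auto
qed

lemma glue_decorated: "decorated (points n n') (glue U V)"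
proof -
  interpret swap: gluable n' n m V U x by (rule gluable_swap)
  show ?thesis
  proof
    fix s assume "s \<in> glue U V"
    then consider i j c where "s = ({North i, North j}, c)" "({North i, North j}, c) \<in> U"
      | i j c where "s = ({South i, South j}, c)" "({North i, North j}, c) \<in> V"
      | i j k c where "s = ({North i, South j}, c)" "({North i, South k}, c) \<in> U" "({North j, South k}, c) \<in> V"
      unfolding glue_def by blast
    then show "\<exists>p\<in>points n n'. \<exists>q\<in>points n n'. \<exists>c. s = ({p, q}, c) \<and> p \<noteq> q"
    proof cases
      case 1
      from U.ends[OF 1(2)] show ?thesis unfolding 1(1)
        by (intro bexI[of _ "North i"] bexI[of _ "North j"] exI[of _ c]) auto
    next
      case 2
      from V.ends[OF 2(2)] show ?thesis unfolding 2(1)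
        by (intro bexI[of _ "South i"] bexI[of _ "South j"] exI[of _ c]) auto
    next
      case 3
      from U.ends[OF 3(2)] V.ends[OF 3(3)] show ?thesis unfolding 3(1)
        by (intro bexI[of _ "North i"] bexI[of _ "South j"] exI[of _ c]) auto
    qed
  next
    fix p assume p: "p \<in> points n n'"
    show "\<exists>y c. ({p, y}, c) \<in> glue U V"
    proof (cases p)
      case (North i)
      then show ?thesis using glue_matched_north p by simp
    next
      case (South j)
      then obtain y c where "({North j, y}, c) \<in> glue V U" using swap.glue_matched_north[of j] p by auto
      then have "({p, flip_point y}, c) \<in> glue U V"
        using mem_glue_swap[of "North j" y c U V] South by simp
      then show ?thesis by blast
    qed
  next
    fix p y c y' c' assume *: "({p, y}, c) \<in> glue U V" "({p, y'}, c') \<in> glue U V"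
    show "y = y' \<and> c = c'"
    proof (cases p)
      case (North i)
      then show ?thesis using glue_unique_north * by blast
    next
      case (South j)
      then have "({North j, flip_point y}, c) \<in> glue V U" "({North j, flip_point y'}, c') \<in> glue V U"
        using * mem_glue_swap[of p y c V U] mem_glue_swap[of p y' c' V U] by simp_all
      from swap.glue_unique_north[OF this] show ?thesis by (metis flip_point_flip_point)
    qed
  next
    fix a b c p y c'
    assume *: "({a, b}, c) \<in> glue U V" "({p, y}, c') \<in> glue U V" "between a b p"
    show "between a b y"
    proof (cases p)
      case (North r)
      then show ?thesis using glue_planar_north * by blast
    next
      case (South r)
      have "({flip_point a, flip_point b}, c) \<in> glue V U" using *(1) by (simp add: mem_glue_swap)
      moreover have "({North r, flip_point y}, c') \<in> glue V U"
        using *(2) mem_glue_swap[of p y c' V U] South by simp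
      moreover have "between (flip_point a) (flip_point b) (North r)"
        using *(3) between_flip_point[of a b p] South by simp
      ultimately have "between (flip_point a) (flip_point b) (flip_point y)"
        by (rule swap.glue_planar_north)
      then show ?thesis by simp
    qed
  next
    fix p y c assume *: "({p, y}, c) \<in> glue U V"
    show "c \<noteq> None \<longleftrightarrow> \<not> covered (glue U V) p"
    proof (cases p)
      case (North i)
      then show ?thesis using glue_decor_north * by blast
    next
      case (South r)
      have "({North r, flip_point y}, c) \<in> glue V U"
        using * mem_glue_swap[of p y c V U] South by simp
      from swap.glue_decor_north[OF this] show ?thesis
        using covered_glue_swap[of p] South by simp
    qed
  qed
qed

text \<open>
  The northern ends of the lines of \<open>V\<close> become the southern ends of the glued lines.
\<close>

lemma south_ends_glue: "south_ends (glue U V) = {j. \<exists>k c. ({North j, South k}, c) \<in> V}"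
proof -
  have "\<exists>i. ({North i, South k}, c) \<in> U" if V: "({North j, South k}, c) \<in> V" for j k c
  proof -
    have "k < m" using V.ends[OF V] by simp
    then obtain i where "({North i, South k}, U.deco_of_line k) \<in> U" using U.decorated_line_exists by blast
    then show ?thesis using V.deco_line[OF V] deco_eq by auto
  qed
  then show ?thesis unfolding south_ends_def mem_glue by blast
qed

lemma line_at_image: "V.line_at ` south_ends (glue U V) = {..<m}"
proof
  show "V.line_at ` south_ends (glue U V) \<subseteq> {..<m}"
  proof clarify
    fix j assume "j \<in> south_ends (glue U V)"
    then obtain k c where V: "({North j, South k}, c) \<in> V" unfolding south_ends_glue by blast
    show "V.line_at j < m" unfolding V.line_at_eq[OF V] using V.ends[OF V] by simp
  qed
  show "{..<m} \<subseteq> V.line_at ` south_ends (glue U V)"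
  proof
    fix k assume "k \<in> {..<m}"
    then obtain j where V: "({North j, South k}, V.deco_of_line k) \<in> V" using V.decorated_line_exists by auto
    then have "j \<in> south_ends (glue U V)" unfolding south_ends_glue by blast
    then show "k \<in> V.line_at ` south_ends (glue U V)" using V.line_at_eq[OF V] by (intro image_eqI) simp_all
  qed
qed

lemma line_at_less:
  assumes "a \<in> south_ends (glue U V)" "b \<in> south_ends (glue U V)"
  shows "V.line_at a < V.line_at b \<longleftrightarrow> a < b"
proof -
  obtain k c k' c' where V: "({North a, South k}, c) \<in> V" "({North b, South k'}, c') \<in> V"
    using assms unfolding south_ends_glue by blast
  show ?thesis
    unfolding V.line_at_eq[OF V(1)] V.line_at_eq[OF V(2)]
    using lines_same_order[OF V.plane_matching_axioms V] by simp
qed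

text \<open>
  The cut numbers the glued lines as they were numbered in the two halves, because
  \<open>V.line_at\<close> is an order isomorphism from the southern ends of the glued lines onto \<open>{..<m}\<close>.
\<close>

lemma rank_south_ends_glue:
  assumes "({North j, South k}, c) \<in> V"
  shows "rank (south_ends (glue U V)) j = k"
proof -
  have "j \<in> south_ends (glue U V)" using assms unfolding south_ends_glue by blast
  from rank_unique[OF line_at_less line_at_image this] show ?thesis
    unfolding V.line_at_eq[OF assms] by simp
qed

lemma card_south_ends_glue: "card (south_ends (glue U V)) = m"
proof -
  have "inj_on V.line_at (south_ends (glue U V))"
    by (rule strict_mono_on_imp_inj_on) (simp add: strict_mono_onI line_at_less)
  from card_image[OF this] show ?thesis unfolding line_at_image by simp
qed

lemma upper_half_glue:
  "upper_half \<lparr>north = n, south = n', strands = glue U V\<rparr> = \<lparr>north = n, south = m, strands = U\<rparr>"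
proof -
  define d where "d = \<lparr>north = n, south = n', strands = glue U V\<rparr>"
  have Db: "d \<in> Db n n'" using glue_decorated by (simp add: d_def Db_iff)
  have card: "card (south_ends (strands d)) = m" by (simp add: d_def card_south_ends_glue)
  note up = upper_half_Db[OF Db, unfolded card]
  have dec: "decorated (points n m) (strands (upper_half d))" using up(1) by (rule Db_decorated)
  have line: "({North i, South k}, c) \<in> U" if *: "({North i, South k}, c) \<in> strands (upper_half d)" for i k c
  proof -
    obtain j where "({North i, South j}, c) \<in> glue U V" "k = rank (south_ends (glue U V)) j"
      using * unfolding up(3) by (auto simp: d_def)
    then show ?thesis using rank_south_ends_glue by (auto simp: mem_glue)
  qed
  have "strands (upper_half d) = U"
  proof (rule plane_matching_eqI)
    show "plane_matching (points n m) (strands (upper_half d))" using dec by (rule decorated.axioms)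
    show "plane_matching (points n m) U" ..
    fix x y c assume xy: "({x, y}, c) \<in> strands (upper_half d)"
    show "({x, y}, c) \<in> U"
    proof (cases x; cases y)
      fix i j assume "x = North i" "y = North j"
      then show ?thesis using xy up(2) by (simp add: d_def mem_glue)
    next
      fix i k assume "x = North i" "y = South k"
      then show ?thesis using xy line by simp
    next
      fix i k assume "x = South k" "y = North i"
      then show ?thesis using xy line by (simp add: insert_commute)
    next
      fix i k assume "x = South k" "y = South i"
      then show ?thesis using xy up(4) by simp
    qed
  qed
  then show ?thesis using up(1) unfolding d_def[symmetric] by (cases "upper_half d") (simp add: Db_iff)
qed

end

definition uncut :: "int \<times> diagram \<times> diagram \<Rightarrow> diagram" where
  "uncut = (\<lambda>(l, u, w). \<lparr>north = north u, south = south w, strands = glue (strands u) (strands (flip w))\<rparr>)"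

text \<open>
  A line of the glued diagram joins the upper end of one line of \<open>d\<close> to the lower end of another line of
  the same rank. As ranks are injective, the two lines are the same.
\<close>

lemma uncut_cut:
  assumes "d \<in> Db n m"
  shows "uncut (cut_diagram d) = d"
proof -
  interpret decorated "points n m" "strands d" using Db_decorated[OF assms] .
  let ?A = "south_ends (strands d)" and ?B = "south_ends (strands (flip d))"
  let ?U = "strands (upper_half d)" and ?V = "strands (upper_half (flip d))"
  note U = upper_half_Db[OF assms] and V = upper_half_Db[OF flip_Db[OF assms]]
  have fin: "finite ?A" using south_ends_subset[OF plane_matching_axioms] finite_subset by blast
  \<comment> \<open>A line has the same number from both edges.\<close>
  have rank: "rank ?B i = rank ?A j" if ij: "({North i, South j}, c) \<in> strands d" for i j c
  proof -
    have e: "{North i, South j} \<in> prop_lines d" using ij unfolding prop_lines_eq by blast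
    have "({North j, South i}, c) \<in> strands (flip d)" using ij by (simp add: insert_commute)
    from cut_point_eq_rank[OF flip_Db[OF assms] this]
    show ?thesis using cut_point_flip[OF assms e] cut_point_eq_rank[OF assms ij] by (simp add: insert_commute)
  qed
  have glue: "glue ?U ?V = strands d"
  proof
    show "glue ?U ?V \<subseteq> strands d"
    proof
      fix s assume "s \<in> glue ?U ?V"
      then consider i j c where "s = ({North i, North j}, c)" "({North i, North j}, c) \<in> ?U"
        | i j c where "s = ({South i, South j}, c)" "({North i, North j}, c) \<in> ?V"
        | i j k c where "s = ({North i, South j}, c)" "({North i, South k}, c) \<in> ?U" "({North j, South k}, c) \<in> ?V"
        unfolding glue_def by blast
      then show "s \<in> strands d"
      proof cases
        case 1
        then show ?thesis using U(2) by simp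
      next
        case 2
        then show ?thesis using V(2) by simp
      next
        case 3
        obtain j' where j': "({North i, South j'}, c) \<in> strands d" "k = rank ?A j'" using 3(2) unfolding U(3) by blast
        obtain i' where "({North j, South i'}, c) \<in> strands (flip d)" "k = rank ?B i'" using 3(3) unfolding V(3) by blast
        then have i': "({North i', South j}, c) \<in> strands d" "k = rank ?A j"
          using rank[of i' j c] by (simp_all add: insert_commute)
        have "j' \<in> ?A" "j \<in> ?A" using j'(1) i'(1) unfolding south_ends_def by blast+
        then have "j' = j" using rank_inj[OF fin] j'(2) i'(2) by simp
        then show ?thesis using j'(1) 3(1) by simp
      qed
    qed
    show "strands d \<subseteq> glue ?U ?V"
    proof
      fix s assume s: "s \<in> strands d"
      have line: "({North i, South j}, c) \<in> glue ?U ?V" if ij: "({North i, South j}, c) \<in> strands d" for i j c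
      proof -
        have "({North i, South (rank ?A j)}, c) \<in> ?U" unfolding U(3) using ij by blast
        moreover have "({North j, South i}, c) \<in> strands (flip d)" using ij by (simp add: insert_commute)
        then have "({North j, South (rank ?B i)}, c) \<in> ?V" unfolding V(3) by blast
        ultimately show ?thesis using rank[OF ij] unfolding mem_glue by auto
      qed
      obtain x y c where xy: "s = ({x, y}, c)" using strand[OF s] by blast
      show "s \<in> glue ?U ?V"
      proof (cases x; cases y)
        fix i j assume "x = North i" "y = North j"
        then show ?thesis using s xy U(2) by (simp add: mem_glue)
      next
        fix i j assume "x = North i" "y = South j"
        then show ?thesis using s xy line by simp
      next
        fix i j assume "x = South j" "y = North i"
        then show ?thesis using s xy line by (simp add: insert_commute)
      next
        fix i j assume "x = South i" "y = South j"
        then show ?thesis using s xy V(2) by (simp add: mem_glue)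
      qed
    qed
  qed
  have "south (flip (upper_half (flip d))) = m" using V(1) by (simp add: flip_def Db_iff)
  then show ?thesis
    using U(1) assms unfolding uncut_def cut_diagram_def prod.case lower_half_eq[OF assms] flip_flip glue
    by (cases d) (simp add: Db_iff)
qed

lemma half_diagram_of_Db_half:
  assumes "u \<in> Db_half n l"
  shows "half_diagram n (nat \<bar>l\<bar>) (strands u) (line_deco l)"
proof -
  have u: "u \<in> Db n (nat \<bar>l\<bar>)" using assms by (simp add: Db_half_iff)
  interpret decorated "points n (nat \<bar>l\<bar>)" "strands u" using Db_decorated[OF u] .
  show ?thesis
    by unfold_locales (use assms in \<open>unfold Db_half_iff, blast+\<close>)
qed

lemma cut_uncut:
  assumes "u \<in> Db_half n l" "v \<in> Db_half n' l"
  shows "uncut (l, u, flip v) \<in> Db n n'" "cut_diagram (uncut (l, u, flip v)) = (l, u, flip v)"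
proof -
  let ?m = "nat \<bar>l\<bar>"
  have u: "u = \<lparr>north = n, south = ?m, strands = strands u\<rparr>" and v: "v = \<lparr>north = n', south = ?m, strands = strands v\<rparr>"
    using assms by (cases u; cases v; simp add: Db_half_iff Db_iff)+
  interpret U: half_diagram n ?m "strands u" "line_deco l" by (rule half_diagram_of_Db_half[OF assms(1)])
  interpret V: half_diagram n' ?m "strands v" "line_deco l" by (rule half_diagram_of_Db_half[OF assms(2)])
  interpret gluable n n' ?m "strands u" "strands v" "line_deco l" ..
  interpret swap: gluable n' n ?m "strands v" "strands u" "line_deco l" by (rule gluable_swap)
  define d where "d = \<lparr>north = n, south = n', strands = glue (strands u) (strands v)\<rparr>"
  have "north u = n" using arg_cong[OF u, of north] by simp
  moreover have "south (flip v) = n'" using arg_cong[OF v, of north] by (simp add: flip_def)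
  ultimately have un: "uncut (l, u, flip v) = d" unfolding uncut_def d_def by simp
  have Db: "d \<in> Db n n'" using glue_decorated by (simp add: d_def Db_iff)
  have flip_d: "flip d = \<lparr>north = n', south = n, strands = glue (strands v) (strands u)\<rparr>"
    by (simp add: flip_eq d_def rename_flip_glue)
  have "upper_half d = u" using upper_half_glue u unfolding d_def by simp
  moreover have "lower_half d = flip v"
    unfolding lower_half_eq[OF Db] flip_d using swap.upper_half_glue v by simp
  moreover have "cut_index d = l"
  proof -
    have card: "card (prop_lines d) = ?m"
      unfolding card_prop_lines[OF Db] using card_south_ends_glue by (simp add: d_def)
    show ?thesis
    proof (cases "l = 0")
      case True
      then show ?thesis using card by (simp add: cut_index_def)
    next
      case False
      then obtain i where i: "({North i, South 0}, Some (line_deco l)) \<in> strands u"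
        using U.decorated_line_exists[of 0] by (auto simp: U.deco_of_line_def)
      then obtain j where "({North i, South j}, Some (line_deco l)) \<in> strands d"
        using extend_line unfolding d_def by (metis diagram.select_convs(3))
      moreover have "t = line_deco l" if "({North p, South q}, Some t) \<in> strands d" for p q t
        using that U.line_decoration unfolding d_def diagram.simps mem_glue by blast
      ultimately have "westernmost_carries d Square \<longleftrightarrow> line_deco l = Square"
        unfolding westernmost_carries_iff[OF Db] by metis
      then show ?thesis using False card by (simp add: cut_index_def line_deco_def)
    qed
  qed
  ultimately show "uncut (l, u, flip v) \<in> Db n n'" "cut_diagram (uncut (l, u, flip v)) = (l, u, flip v)"
    unfolding un using Db by (simp_all add: cut_diagram_def)
qed

lemma cut_diagram_bij:
  "bij_betw cut_diagram (Db n m) (SIGMA l:UNIV. Db_half n l \<times> Db_lower_half m l)"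
proof (rule bij_betw_byWitness[where f' = uncut])
  show "\<forall>d\<in>Db n m. uncut (cut_diagram d) = d" using uncut_cut by blast
  show "\<forall>t\<in>SIGMA l:UNIV. Db_half n l \<times> Db_lower_half m l. cut_diagram (uncut t) = t"
    using cut_uncut(2) by (auto simp: Db_lower_half_def)
  show "cut_diagram ` Db n m \<subseteq> (SIGMA l:UNIV. Db_half n l \<times> Db_lower_half m l)"
    using cut_diagram_in_halves by blast
  show "uncut ` (SIGMA l:UNIV. Db_half n l \<times> Db_lower_half m l) \<subseteq> Db n m"
    using cut_uncut(1) by (auto simp: Db_lower_half_def)
qed

text \<open>
  Pascal arrays are transported along injections by conjugating the edge maps.
\<close>

lemma pascal_array_image:
  assumes "pascal_array G v0 Y \<phi>" "inj g"
  shows "pascal_array G v0 (\<lambda>n v. g ` Y n v) (\<lambda>n e. g \<circ> \<phi> n e \<circ> inv g)"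
proof -
  have "(g \<circ> \<phi> n e \<circ> inv g) ` g ` Y k v = g ` \<phi> n e ` Y k v" for n e k v
    using assms(2) by (simp add: image_comp o_def inv_f_f[OF assms(2)])
  moreover have "inj_on (g \<circ> \<phi> n e \<circ> inv g) (g ` Y k v)" if "inj_on (\<phi> n e) (Y k v)" for n e k v
    using that assms(2) by (auto simp: inj_on_def)
  ultimately show ?thesis
    using assms by (auto simp: pascal_array_def image_UN disjoint_family_on_def image_Int[symmetric])
qed

theorem proposition5p1:
  shows "pascal_array A_inf_inf 0 Db_half (\<lambda>n. edge_map) \<and>
         underlies A_inf_inf 0 Db_half (\<lambda>n. Db n n) Db_lower_half (\<lambda>n. cut_diagram)"
proof
  show "pascal_array A_inf_inf 0 Db_half (\<lambda>n. edge_map)" by (rule pascal_array_Db_half)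
  moreover have "pascal_array A_inf_inf 0 Db_lower_half (\<lambda>n e. flip \<circ> edge_map e \<circ> inv flip)"
    using pascal_array_image[OF pascal_array_Db_half inj_flip] unfolding Db_lower_half_def .
  ultimately show "underlies A_inf_inf 0 Db_half (\<lambda>n. Db n n) Db_lower_half (\<lambda>n. cut_diagram)"
    unfolding underlies_def A_inf_inf_simps using sym_A_inf_inf cut_diagram_bij by blast
qed

end
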